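(* Let $\alpha$ be a probability distribution on $(0,1)$ with $\langle\log\rho(0)\rangle\le 0$, let $\mu=\alpha^{\mathbb{Z}}$, and let $X=(X_n)_{n\in\mathbb{N}_0}$ be the random walk in cooling random environment with resampling rule $\alpha$ and cooling rule $\tau$. Suppose that $\tau(k)\sim Ak$ as $k\to\infty$ for some $A\in(1,\infty)$, and that there is a probability measure $\nu$ on $\mathbb{N}$ such that $$\lim_{n\to\infty}\sum_{\ell\in\mathbb{N}}\ell\,|L_n(\ell)-\nu(\ell)|=0,$$ where $L_n=\frac{1}{k(n)}\sum_{k=1}^{k(n)}\delta_{\tau(k)-\tau(k-1)}$ (defined for $n$ large enough that $k(n)\ge 1$). Put $$v_\nu=\frac1A\sum_{\ell\in\mathbb{N}}\nu(\ell)\,\mathbb{E}_\mu(Z_\ell),\qquad \sigma_\nu^2=\frac1A\sum_{\ell\in\mathbb{N}}\nu(\ell)\,\mathrm{Var}_\mu(Z_\ell).$$ Then the following hold. (1) Strong law of large numbers: $\lim_{n\to\infty}X_n/n=v_\nu$ $\mathbb{P}_{\mathbb{Q}}$-almost surely. (2) Central limit theorem: under the law $\mathbb{P}_{\mathbb{Q}}$, $$\frac{X_n-v_\nu n}{\sigma_\nu\sqrt n}\ \text{ converges in distribution to } \mathcal{N}(0,1)\quad\text{as } n\to\infty,$$ provided that (i) $\bar T^n=o(\sqrt n)$ and (ii) $\sum_{\ell\in\mathbb{N}}\ell\,|L_n(\ell)-\nu(\ell)|=o(1/\sqrt n)$ as $n\to\infty$.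
   Context: $\mathbb{N}=\{1,2,\dots\}$, $\mathbb{N}_0=\mathbb{N}\cup\{0\}$; $\langle\cdot\rangle$ denotes expectation with respect to $\alpha$, and $\rho(0)=(1-\omega(0))/\omega(0)$ where $\omega(0)$ has law $\alpha$. Static model (RWRE): $\omega=\{\omega(x):x\in\mathbb{Z}\}$ is i.i.d. with law $\mu=\alpha^{\mathbb{Z}}$. Given $\omega$, $Z=(Z_n)_{n\in\mathbb{N}_0}$ is the Markov chain on $\mathbb{Z}$ with $Z_0=0$ that jumps from $x$ to $x+1$ with probability $\omega(x)$ and to $x-1$ with probability $1-\omega(x)$; its law is $P^\omega$. The annealed law is $\mathbb{P}_\mu(\cdot)=\int P^\omega(\cdot)\,\mu(d\omega)$, with expectation $\mathbb{E}_\mu$ and variance $\mathrm{Var}_\mu$. Cooling model (RWCRE): the cooling rule $\tau:\mathbb{N}_0\to\mathbb{N}_0$ is strictly increasing with $\tau(0)=0$ (so $\tau(k)\ge k$). The sequence of environments $\Omega=(\omega_n)_{n\in\mathbb{N}_0}$ is defined as follows: the environments $\omega_{\tau(k)}$, $k\in\mathbb{N}_0$, are independent with law $\mu=\alpha^{\mathbb{Z}}$, and $\omega_n=\omega_{\tau(k)}$ for $\tau(k)\le n<\tau(k+1)$. The law of $\Omega$ is $\mathbb{Q}=\mathbb{Q}_{\alpha,\tau}$. Given $\Omega$, $X=(X_n)_{n\in\mathbb{N}_0}$ is the (time-inhomogeneous) Markov process on $\mathbb{Z}$ with $X_0=0$ that, at time $n$ at position $x$, jumps to $x+1$ with probability $\omega_n(x)$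 and to $x-1$ with probability $1-\omega_n(x)$; its law is $P^\Omega$. The annealed law is $\mathbb{P}_{\mathbb{Q}}(\cdot)=\int P^\Omega(\cdot)\,\mathbb{Q}(d\Omega)$. $k(n)=\max\{k\in\mathbb{N}_0:\tau(k)\le n\}$ is the index of the last resampling up to time $n$, and $\bar T^n=n-\tau(k(n))$. *)

theory Defs
  imports "HOL-Probability.Probability" "HOL-Library.Landau_Symbols"
begin

text \<open>
  The expectation of the logarithm of \<open>\<rho> = (1 - p) / p\<close>, where \<open>p\<close> has law \<open>\<alpha>\<close>, as an extended
  real: positive part minus negative part. No integrability is presupposed, so the value may be
  \<open>-\<infinity>\<close>. If both parts are infinite, the expectation is undefined; as \<open>\<infinity> - \<infinity> = \<infinity>\<close> in
  \<^typ>\<open>ereal\<close>, the condition \<open>mean_log_rho \<alpha> \<le> 0\<close> then fails.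
\<close>

definition mean_log_rho :: "real measure \<Rightarrow> ereal" where
  "mean_log_rho \<alpha> =
     enn2ereal (\<integral>\<^sup>+p. ennreal (ln ((1 - p) / p)) \<partial>\<alpha>)
     - enn2ereal (\<integral>\<^sup>+p. ennreal (- ln ((1 - p) / p)) \<partial>\<alpha>)"

definition env_law :: "real measure \<Rightarrow> (int \<Rightarrow> real) measure" where
  "env_law \<alpha> = (\<Pi>\<^sub>M x\<in>UNIV. \<alpha>)"

text \<open>
  \<open>walk_step \<Omega> i h\<close> is the law of the position at time \<open>i\<close>, given the positions \<open>h\<close> at the times
  before \<open>i\<close>. \<^const>\<open>bernoulli_pmf\<close> clips its argument to the unit interval, which has no effect on
  environments with values in \<open>(0,1)\<close>.
\<close>

definition walk_step :: "(nat \<Rightarrow> int \<Rightarrow> real) \<Rightarrow> nat \<Rightarrow> (nat \<Rightarrow> int) \<Rightarrow> int measure" where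
  "walk_step \<Omega> i h = measure_pmf (case i of
       0 \<Rightarrow> return_pmf 0
     | Suc n \<Rightarrow> map_pmf (\<lambda>b. if b then h n + 1 else h n - 1) (bernoulli_pmf (\<Omega> n (h n))))"

lemma Ionescu_Tulcea_walk_step:
  "Ionescu_Tulcea (walk_step \<Omega>) (\<lambda>_. count_space UNIV)"
proof (rule Ionescu_Tulcea.intro)
  fix i
  show "walk_step \<Omega> i \<in> PiM {0..<i} (\<lambda>_. count_space UNIV) \<rightarrow>\<^sub>M subprob_algebra (count_space UNIV)"
  proof (cases i)
    case 0
    then show ?thesis
      by (simp add: walk_step_def[abs_def] measurable_measure_pmf)
  next
    case (Suc n)
    have "(\<lambda>x. measure_pmf (map_pmf (\<lambda>b. if b then x + 1 else x - 1) (bernoulli_pmf (\<Omega> n x))))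
        \<in> count_space UNIV \<rightarrow>\<^sub>M subprob_algebra (count_space (UNIV :: int set))"
      by (auto simp: space_subprob_algebra intro!: prob_space_imp_subprob_space prob_space_measure_pmf)
    moreover have "(\<lambda>h. h n) \<in> PiM {0..<i} (\<lambda>_. count_space (UNIV :: int set)) \<rightarrow>\<^sub>M count_space UNIV"
      using Suc by (intro measurable_component_singleton) auto
    ultimately show ?thesis
      unfolding walk_step_def[abs_def] Suc nat.case by (rule measurable_compose[rotated])
  qed
next
  fix i and h :: "nat \<Rightarrow> int"
  show "prob_space (walk_step \<Omega> i h)"
    by (simp add: walk_step_def prob_space_measure_pmf)
qed

text \<open>
  The quenched law: the Ionescu-Tulcea measure on paths \<open>nat \<Rightarrow> int\<close> (with the product
  \<open>\<sigma>\<close>-algebra) generated by the kernels \<^const>\<open>walk_step\<close>. At time \<open>n\<close> the walk uses the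
  environment \<open>\<Omega> n\<close>.
\<close>

definition quenched_law :: "(nat \<Rightarrow> int \<Rightarrow> real) \<Rightarrow> (nat \<Rightarrow> int) measure" where
  "quenched_law \<Omega> =
     projective_family.lim UNIV (Ionescu_Tulcea.CI (walk_step \<Omega>) (\<lambda>_. count_space UNIV))
       (\<lambda>_. count_space UNIV)"

definition rwre_law :: "real measure \<Rightarrow> (nat \<Rightarrow> int) measure" where
  "rwre_law \<alpha> = env_law \<alpha> \<bind> (\<lambda>\<omega>. quenched_law (\<lambda>_. \<omega>))"

definition rwre_mean :: "real measure \<Rightarrow> nat \<Rightarrow> real" where
  "rwre_mean \<alpha> l = (\<integral>z. real_of_int (z l) \<partial>rwre_law \<alpha>)"

definition rwre_var :: "real measure \<Rightarrow> nat \<Rightarrow> real" where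
  "rwre_var \<alpha> l = (\<integral>z. (real_of_int (z l) - rwre_mean \<alpha> l)\<^sup>2 \<partial>rwre_law \<alpha>)"

definition cooling_rule :: "(nat \<Rightarrow> nat) \<Rightarrow> bool" where
  "cooling_rule \<tau> \<longleftrightarrow> strict_mono \<tau> \<and> \<tau> 0 = 0"

definition last_resampling :: "(nat \<Rightarrow> nat) \<Rightarrow> nat \<Rightarrow> nat" where
  "last_resampling \<tau> n = Max {k. \<tau> k \<le> n}"

text \<open>
  The law of the environment sequence: from independent environments \<open>\<eta> k\<close> with law
  \<open>env_law \<alpha>\<close>, where \<open>\<eta> k\<close> is the environment sampled at time \<open>\<tau> k\<close>, the environment at time \<open>n\<close>
  is the one sampled most recently.
\<close>

definition cooling_env_law :: "real measure \<Rightarrow> (nat \<Rightarrow> nat) \<Rightarrow> (nat \<Rightarrow> int \<Rightarrow> real) measure" where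
  "cooling_env_law \<alpha> \<tau> =
     distr (\<Pi>\<^sub>M k\<in>UNIV. env_law \<alpha>) (\<Pi>\<^sub>M n\<in>UNIV. env_law \<alpha>) (\<lambda>\<eta> n. \<eta> (last_resampling \<tau> n))"

definition rwcre_law :: "real measure \<Rightarrow> (nat \<Rightarrow> nat) \<Rightarrow> (nat \<Rightarrow> int) measure" where
  "rwcre_law \<alpha> \<tau> = cooling_env_law \<alpha> \<tau> \<bind> quenched_law"

definition increment_freq :: "(nat \<Rightarrow> nat) \<Rightarrow> nat \<Rightarrow> nat \<Rightarrow> real" where
  "increment_freq \<tau> n l =
     (\<Sum>k = 1..last_resampling \<tau> n. of_bool (\<tau> k - \<tau> (k - 1) = l)) / real (last_resampling \<tau> n)"

text \<open>
  The weighted distance between \<open>L\<^sub>n\<close> and \<open>\<nu>\<close>. The sum is taken in \<^typ>\<open>ennreal\<close>, so that a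
  divergent sum has the value \<open>\<infinity>\<close>. The term for \<open>l = 0\<close> vanishes.
\<close>

definition increment_dist :: "(nat \<Rightarrow> nat) \<Rightarrow> nat pmf \<Rightarrow> nat \<Rightarrow> ennreal" where
  "increment_dist \<tau> \<nu> n = (\<Sum>l. ennreal (real l * \<bar>increment_freq \<tau> n l - pmf \<nu> l\<bar>))"

definition v_nu :: "real measure \<Rightarrow> real \<Rightarrow> nat pmf \<Rightarrow> real" where
  "v_nu \<alpha> A \<nu> = 1 / A * (\<Sum>l. pmf \<nu> l * rwre_mean \<alpha> l)"

text \<open>
  The series in \<open>v_nu\<close> is absolutely convergent as soon as \<open>\<nu>\<close> has a finite mean, because
  \<open>\<bar>Z l\<bar> \<le> l\<close>. The one in \<open>sigma_nu\<close> may diverge, in which case \<open>sigma_nu\<close> is meaningless.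
\<close>

definition sigma_nu :: "real measure \<Rightarrow> real \<Rightarrow> nat pmf \<Rightarrow> real" where
  "sigma_nu \<alpha> A \<nu> = sqrt (1 / A * (\<Sum>l. pmf \<nu> l * rwre_var \<alpha> l))"

end

theory Submission
  imports Defs
begin

text \<open>
  Resampling the environment makes the walk on the blocks \<open>[\<tau> (k - 1), \<tau> k)\<close> independent, and the
  environment law is translation invariant, so the cooled walk has the law of a concatenation of
  independent copies of the static walk, the \<open>k\<close>-th run for the length of the \<open>k\<close>-th block. Hence
  \<open>X\<close> is, up to the unfinished block, a sum of independent increments bounded by the block lengths.

  Strong law: the convergence of the block frequencies is uniform on functions of at most linear
  growth, so long blocks cover a small fraction of time, while on short blocks Hoeffding's inequality
  and Borel--Cantelli apply; the means average to \<open>A v\<^sub>\<nu>\<close>. Central limit theorem: the first condition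
  forces all blocks up to time \<open>n\<close> to have length \<open>o(\<surd>n)\<close>, so the increments are uniformly small.
  The functions cut off at \<open>l \<le> \<surd>n\<close> have growth rate \<open>\<surd>n\<close>, so the second condition yields
  convergence of the averaged variances although these may grow quadratically in the block length.
\<close>

section \<open>Cylinder probabilities\<close>

text \<open>The cooled walk is given as an integral of Ionescu-Tulcea measures over environment
  sequences, so the independence of blocks is not visible in its definition. It is recovered through
  an identity in law that is tested only on cylinders ending at a resampling time: there the weight
  of a path is exactly a product with one factor per environment. As \<open>\<tau>\<close> is
  unbounded, these cylinders still generate the path space, and the identity concerns whole paths,
  so almost sure statements transfer as well as distributional ones. The linear weight in the
  distance has two further uses. With the identity as test function it gives \<open>\<nu>\<close>
  the mean \<open>A\<close>, so no mass escapes to long blocks, and it yields a rate for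
  \<open>\<tau> k / k\<close>, which the centering in the central limit theorem needs. All blocks
  are small because the condition on the unfinished block can be read just before a resampling, when
  all but one step of a block counts as unfinished. The normalisation is legitimate because
  \<open>\<alpha>\<close> lives on the open interval: both straight paths have positive probability,
  so the static walk has positive variance at every positive time.\<close>

abbreviation path_space :: "(nat \<Rightarrow> int) measure" where
  "path_space \<equiv> \<Pi>\<^sub>M n\<in>UNIV. count_space UNIV"

definition path_cylinder :: "nat \<Rightarrow> (nat \<Rightarrow> int) \<Rightarrow> (nat \<Rightarrow> int) set" where
  "path_cylinder n h = {x. \<forall>i\<le>n. x i = h i}"

definition step_prob :: "real \<Rightarrow> int \<Rightarrow> real" where
  "step_prob p d = pmf (map_pmf (\<lambda>b. if b then 1 else - 1) (bernoulli_pmf p)) d"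

definition path_weight :: "nat \<Rightarrow> (nat \<Rightarrow> int) \<Rightarrow> (nat \<Rightarrow> int \<Rightarrow> real) \<Rightarrow> real" where
  "path_weight n h \<Omega> = (\<Prod>i<n. step_prob (\<Omega> i (h i)) (h (Suc i) - h i))"

lemma step_prob_nonneg [simp]: "0 \<le> step_prob p d"
  by (simp add: step_prob_def)

text \<open>The clipping of \<open>bernoulli_pmf\<close> is kept explicit so that the formula holds
  for every real \<open>p\<close>; measurability in the environment can then be shown on all of
  \<open>borel\<close>.\<close>

lemma step_prob_eq:
  "step_prob p d = (if d = 1 then max 0 (min 1 p) else if d = -1 then 1 - max 0 (min 1 p) else 0)"
proof -
  have b: "pmf (bernoulli_pmf p) True = max 0 (min 1 p)"
    by (cases "0 \<le> p"; cases "p \<le> 1") (auto simp: bernoulli_pmf.rep_eq)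
  have "pmf (bernoulli_pmf p) False = 1 - pmf (bernoulli_pmf p) True"
    by (cases "0 \<le> p"; cases "p \<le> 1") (auto simp: bernoulli_pmf.rep_eq)
  have e: "(\<lambda>b::bool. if b then 1 else -1 :: int) -` {d}
     = (if d = 1 then {True} else if d = -1 then {False} else {})"
    by (auto split: if_splits)
  show ?thesis unfolding step_prob_def pmf_map e
    using b \<open>pmf (bernoulli_pmf p) False = 1 - pmf (bernoulli_pmf p) True\<close>
    by (auto simp: pmf.rep_eq)
qed

lemma step_prob_measurable [measurable]: "(\<lambda>p. step_prob p d) \<in> borel_measurable borel"
  unfolding step_prob_eq by measurable

lemma emeasure_walk_step_Suc:
  "emeasure (walk_step \<Omega> (Suc n) x) {y} = ennreal (step_prob (\<Omega> n (x n)) (y - x n))"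
proof -
  have "map_pmf (\<lambda>b. if b then x n + 1 else x n - 1) (bernoulli_pmf (\<Omega> n (x n)))
      = map_pmf (\<lambda>d. x n + d) (map_pmf (\<lambda>b. if b then 1 else -1) (bernoulli_pmf (\<Omega> n (x n))))"
    unfolding map_pmf_comp by (intro map_pmf_cong) auto
  moreover have "pmf (map_pmf (\<lambda>d. x n + d) P) y = pmf P (y - x n)" for P
    using pmf_map_inj'[of "\<lambda>d. x n + d" P "y - x n"] by (simp add: inj_def)
  ultimately show ?thesis
    by (simp add: walk_step_def emeasure_pmf_single step_prob_def)
qed

text \<open>Induction on the time: each kernel pins one more coordinate and contributes the factor
  of one step. The initial kernel is the point mass at 0, which accounts for the case distinction on
  \<open>h 0\<close>. Pinning the times up to \<open>n\<close> takes \<open>Suc n\<close> kernels,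
  but only \<open>n\<close> of them are steps.\<close>

lemma emeasure_IT_path:
  fixes \<Omega> h
  defines "C \<equiv> Ionescu_Tulcea.C (walk_step \<Omega>) (\<lambda>_. count_space UNIV)"
  shows "emeasure (C 0 (Suc n) (\<lambda>_. undefined)) (\<Pi>\<^sub>E i\<in>{0..<Suc n}. {h i})
    = (if h 0 = 0 then ennreal (path_weight n h \<Omega>) else 0)"
proof -
  interpret IT: Ionescu_Tulcea "walk_step \<Omega>" "\<lambda>_. count_space UNIV"
    by (rule Ionescu_Tulcea_walk_step)
  let ?E = "\<lambda>n. \<Pi>\<^sub>E i\<in>{0..<n}. {h i}"
  have E_sets: "?E n \<in> sets (PiM {0..<n} (\<lambda>_. count_space UNIV))" for n
    by (intro sets_PiM_I_finite) auto
  have space: "space (IT.C 0 n (\<lambda>_. undefined)) = space (PiM {0..<n} (\<lambda>_. count_space UNIV))" for n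
    using IT.space_C[of "\<lambda>_. undefined" 0 n] by (auto simp: space_PiM)
  have sets: "sets (IT.C 0 n (\<lambda>_. undefined)) = sets (PiM {0..<n} (\<lambda>_. count_space UNIV))" for n
    using IT.sets_C[of "\<lambda>_. undefined" 0 n] by (auto simp: space_PiM)
  have eP: "emeasure (IT.eP n x) (?E (Suc n)) = indicator (?E n) x * emeasure (walk_step \<Omega> n x) {h n}"
    if x: "x \<in> space (PiM {0..<n} (\<lambda>_. count_space UNIV))" for n x
  proof -
    have "(\<lambda>y. x(n := y)) -` ?E (Suc n) \<inter> UNIV = (if x \<in> ?E n then {h n} else {})"
    proof -
      have "x(n := y) \<in> ?E (Suc n) \<longleftrightarrow> x \<in> ?E n \<and> y = h n" for y
        using x by (auto simp: PiE_iff extensional_def space_PiM less_Suc_eq)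
      then show ?thesis by auto
    qed
    then show ?thesis
      using IT.emeasure_eP[OF x E_sets[of "Suc n"]] by simp
  qed
  have step: "emeasure (IT.C 0 (Suc n) (\<lambda>_. undefined)) (?E (Suc n))
      = (\<integral>\<^sup>+x. indicator (?E n) x * emeasure (walk_step \<Omega> n x) {h n} \<partial>IT.C 0 n (\<lambda>_. undefined))" for n
  proof -
    have "emeasure (IT.C 0 (Suc n) (\<lambda>_. undefined)) (?E (Suc n))
        = (\<integral>\<^sup>+x. emeasure (IT.eP n x) (?E (Suc n)) \<partial>IT.C 0 n (\<lambda>_. undefined))"
      unfolding IT.C.simps
    proof (subst emeasure_bind[OF _ _ E_sets[of "Suc n"]])
      show "space (IT.C 0 n (\<lambda>_. undefined)) \<noteq> {}"
        unfolding space by (simp add: space_PiM PiE_eq_empty_iff)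
      show "IT.eP (0 + n) \<in> IT.C 0 n (\<lambda>_. undefined) \<rightarrow>\<^sub>M
          subprob_algebra (PiM {0..<Suc n} (\<lambda>_. count_space UNIV))"
        using IT.measurable_eP[of n] by (simp add: measurable_cong_sets[OF sets refl])
    qed simp
    also have "\<dots> = (\<integral>\<^sup>+x. indicator (?E n) x * emeasure (walk_step \<Omega> n x) {h n} \<partial>IT.C 0 n (\<lambda>_. undefined))"
      by (intro nn_integral_cong eP) (simp add: space)
    finally show ?thesis .
  qed
  have "emeasure (IT.C 0 (Suc n) (\<lambda>_. undefined)) (?E (Suc n))
    = (if h 0 = 0 then ennreal (path_weight n h \<Omega>) else 0)"
  proof (induction n)
    case 0
    have "emeasure (IT.C 0 (Suc 0) (\<lambda>_. undefined)) (?E (Suc 0))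
       = (\<integral>\<^sup>+x. indicator {0} (h 0) \<partial>return (PiM {0..<0::nat} (\<lambda>_. count_space UNIV)) (\<lambda>_. undefined :: int))"
      unfolding step unfolding IT.C.simps(1)
      by (intro nn_integral_cong)
        (auto simp: walk_step_def emeasure_return space_PiM split: split_indicator)
    also have "\<dots> = indicator {0} (h 0)"
      by (subst nn_integral_return) (auto simp: space_PiM)
    finally show ?case
      by (simp add: path_weight_def split: split_indicator)
  next
    case (Suc n)
    \<comment> \<open>On the box the last position is \<open>h n\<close>, so the step factor is
      constant there and leaves the integral.\<close>
    have "emeasure (IT.C 0 (Suc (Suc n)) (\<lambda>_. undefined)) (?E (Suc (Suc n)))
       = (\<integral>\<^sup>+x. ennreal (step_prob (\<Omega> n (h n)) (h (Suc n) - h n)) * indicator (?E (Suc n)) x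
            \<partial>IT.C 0 (Suc n) (\<lambda>_. undefined))"
      unfolding step[of "Suc n"]
      by (intro nn_integral_cong) (auto simp: emeasure_walk_step_Suc PiE_iff split: split_indicator)
    also have "\<dots> = ennreal (step_prob (\<Omega> n (h n)) (h (Suc n) - h n))
        * emeasure (IT.C 0 (Suc n) (\<lambda>_. undefined)) (?E (Suc n))"
      by (rule nn_integral_cmult_indicator) (use E_sets[of "Suc n"] sets[of "Suc n"] in simp)
    finally show ?case unfolding Suc.IH
      by (simp add: path_weight_def ennreal_mult[symmetric] prod_nonneg mult.commute)
  qed
  then show ?thesis by (simp add: C_def)
qed

lemma sets_quenched_law [measurable_cong, simp]: "sets (quenched_law \<Omega>) = sets path_space"
  and prob_space_quenched_law: "prob_space (quenched_law \<Omega>)"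
  and emeasure_quenched_law_cylinder:
    "emeasure (quenched_law \<Omega>) (path_cylinder n h) = (if h 0 = 0 then ennreal (path_weight n h \<Omega>) else 0)"
proof -
  interpret IT: Ionescu_Tulcea "walk_step \<Omega>" "\<lambda>_. count_space UNIV"
    by (rule Ionescu_Tulcea_walk_step)
  have q: "quenched_law \<Omega> = IT.PF.lim"
    by (simp add: quenched_law_def)
  show "sets (quenched_law \<Omega>) = sets path_space"
    by (simp add: q)
  have J: "finite {0..<Suc n}" by simp
  have E_sets: "(\<Pi>\<^sub>E i\<in>{0..<n}. {h i}) \<in> sets (PiM {0..<n} (\<lambda>_. count_space UNIV))" for n
    by (intro sets_PiM_I_finite) auto
  have "path_cylinder n h = prod_emb UNIV (\<lambda>_. count_space UNIV) {0..<Suc n} (\<Pi>\<^sub>E i\<in>{0..<Suc n}. {h i})"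
    by (auto simp: path_cylinder_def prod_emb_def PiE_iff extensional_def space_PiM less_Suc_eq_le
      restrict_def)
  then have "emeasure (quenched_law \<Omega>) (path_cylinder n h)
      = emeasure (IT.CI {0..<Suc n}) (\<Pi>\<^sub>E i\<in>{0..<Suc n}. {h i})"
    unfolding q using IT.lim[OF J E_sets[of "Suc n"]] by simp
  also have "\<dots> = emeasure (IT.C 0 (Suc n) (\<lambda>_. undefined)) (\<Pi>\<^sub>E i\<in>{0..<Suc n}. {h i})"
    by (subst IT.emeasure_CI[OF order_refl E_sets[of "Suc n"]])
       (intro arg_cong2[where f=emeasure] refl, auto simp: prod_emb_def space_PiM PiE_iff extensional_def restrict_def fun_eq_iff)
  finally show "emeasure (quenched_law \<Omega>) (path_cylinder n h) = (if h 0 = 0 then ennreal (path_weight n h \<Omega>) else 0)"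
    by (simp only: emeasure_IT_path)
  \<comment> \<open>The total mass is read off from the marginal with empty index set, whose
    embedding is the whole path space.\<close>
  have "prob_space (IT.CI {})" by (rule IT.PF.prob_space_P) auto
  then have "emeasure (IT.CI {}) (space (PiM {} (\<lambda>_. count_space UNIV))) = 1"
    using prob_space.emeasure_space_1[of "IT.CI {}"] by (simp add: IT.CI_def)
  moreover have "space path_space = prod_emb UNIV (\<lambda>_. count_space UNIV) {} (space (PiM {} (\<lambda>_. count_space UNIV)))"
    by (auto simp: prod_emb_def space_PiM)
  ultimately show "prob_space (quenched_law \<Omega>)"
    using IT.lim[of "{}" "space (PiM {} (\<lambda>_. count_space UNIV))"]
    by (intro prob_spaceI) (simp add: q)
qed

text \<open>The set \<open>S\<close> restricts the end times, so that later only resampling times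
  need be considered. The empty set is included because incompatible cylinders are disjoint, and
  \<open>UNIV\<close> because uniqueness of measures asks for an exhaustion of the space by members
  of the generator.\<close>

definition cylinders :: "nat set \<Rightarrow> (nat \<Rightarrow> int) set set" where
  "cylinders S = {UNIV, {}} \<union> {path_cylinder n h | n h. n \<in> S}"

lemma space_path_space [simp]: "space path_space = UNIV"
  by (simp add: space_PiM)

lemma sets_path_cylinder [measurable, simp]: "path_cylinder n h \<in> sets path_space"
proof -
  have "Measurable.pred path_space (\<lambda>x. \<forall>i\<in>{..n}. x i = h i)"
    by measurable
  moreover have "path_cylinder n h = {x \<in> space path_space. \<forall>i\<in>{..n}. x i = h i}"
    by (auto simp: path_cylinder_def)
  ultimately show ?thesis by (simp add: pred_def)
qed

lemma Int_stable_cylinders: "Int_stable (cylinders S)"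
proof -
  have *: "path_cylinder n g \<inter> path_cylinder m h \<in> cylinders S" if "n \<le> m" "n \<in> S" "m \<in> S" for n m g h
  proof (cases "\<forall>i\<le>n. g i = h i")
    case True
    then have "path_cylinder n g \<inter> path_cylinder m h = path_cylinder m h"
      using that by (auto simp: path_cylinder_def)
    then show ?thesis using that by (auto simp: cylinders_def)
  next
    case False
    then have "path_cylinder n g \<inter> path_cylinder m h = {}"
      using that by (auto simp: path_cylinder_def)
    then show ?thesis by (auto simp: cylinders_def)
  qed
  have "path_cylinder n g \<inter> path_cylinder m h \<in> cylinders S" if "n \<in> S" "m \<in> S" for n m g h
    using *[of n m g h] *[of m n h g] that by (cases "n \<le> m") (auto simp: Int_commute)
  moreover have "a = UNIV \<or> a = {} \<or> (\<exists>n h. n \<in> S \<and> a = path_cylinder n h)"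
    "UNIV \<in> cylinders S" "{} \<in> cylinders S" if "a \<in> cylinders S" for a
    using that by (auto simp: cylinders_def)
  ultimately have "a \<inter> b \<in> cylinders S" if "a \<in> cylinders S" "b \<in> cylinders S" for a b
    using that by (metis Int_UNIV_left Int_UNIV_right Int_empty_left Int_empty_right)
  then show ?thesis
    unfolding Int_stable_def by blast
qed

text \<open>A condition on coordinate \<open>i\<close> is a union of cylinders with any end time
  beyond \<open>i\<close>; infinitely many end times therefore suffice.\<close>

lemma sets_path_space_cylinders:
  assumes "infinite S"
  shows "sets path_space = sigma_sets UNIV (cylinders S)"
proof (rule antisym)
  show "sigma_sets UNIV (cylinders S) \<subseteq> sets path_space"
  proof (rule sets.sigma_sets_subset[of "cylinders S" path_space, unfolded space_path_space])
    have "UNIV \<in> sets path_space" by (metis sets.top space_path_space)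
    then show "cylinders S \<subseteq> sets path_space" by (auto simp: cylinders_def)
  qed
  show "sets path_space \<subseteq> sigma_sets UNIV (cylinders S)"
    unfolding sets_PiM_single
  proof (simp only: PiE_UNIV_domain space_count_space Pi_UNIV, rule sigma_sets_mono, safe)
    fix i :: nat and B :: "int set"
    obtain n where n: "n \<in> S" "i \<le> n"
      using assms by (meson infinite_nat_iff_unbounded_le)
    \<comment> \<open>Initial segments are coded as lists to make the union countable; it could not
      be indexed by the uncountably many paths \<open>h\<close>.\<close>
    have "{f \<in> UNIV. f i \<in> B} = (\<Union>hs\<in>{hs. length hs = Suc n \<and> hs ! i \<in> B}. path_cylinder n (\<lambda>i. hs ! i))"
    proof safe
      fix f :: "nat \<Rightarrow> int" assume "f i \<in> B"
      then show "f \<in> (\<Union>hs\<in>{hs. length hs = Suc n \<and> hs ! i \<in> B}. path_cylinder n (\<lambda>i. hs ! i))"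
        using n by (intro UN_I[of "map f [0..<Suc n]"])
          (auto simp: path_cylinder_def nth_append less_Suc_eq_le simp del: upt_Suc)
    qed (use n in \<open>auto simp: path_cylinder_def\<close>)
    also have "\<dots> \<in> sigma_sets UNIV (cylinders S)"
      using n by (intro sigma_sets_UNION[OF countable_image]) (auto simp: cylinders_def intro!: sigma_sets.Basic)
    finally show "{f \<in> UNIV. f i \<in> B} \<in> sigma_sets UNIV (cylinders S)" .
  qed
qed

lemma path_law_eqI:
  assumes "prob_space M" "prob_space N" "sets M = sets path_space" "sets N = sets path_space"
    and "infinite S"
    and eq: "\<And>n h. n \<in> S \<Longrightarrow> emeasure M (path_cylinder n h) = emeasure N (path_cylinder n h)"
  shows "M = N"
proof (rule measure_eqI_generator_eq[where E="cylinders S" and A="\<lambda>_. UNIV" and \<Omega>=UNIV])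
  have sp: "space M = UNIV" "space N = UNIV"
    using assms(3,4)[THEN sets_eq_imp_space_eq] by auto
  have one: "emeasure M UNIV = 1" "emeasure N UNIV = 1"
    using prob_space.emeasure_space_1[OF assms(1)] prob_space.emeasure_space_1[OF assms(2)]
    by (auto simp: sp)
  show "emeasure M X = emeasure N X" if "X \<in> cylinders S" for X
    using that eq by (auto simp: cylinders_def one)
  show "emeasure M UNIV \<noteq> \<infinity>" by (simp add: one)
  show "sets M = sigma_sets UNIV (cylinders S)" "sets N = sigma_sets UNIV (cylinders S)"
    using assms sets_path_space_cylinders[OF \<open>infinite S\<close>] by auto
qed (use Int_stable_cylinders[of S] in \<open>auto simp: cylinders_def\<close>)

section \<open>Countable products of copies of one probability measure\<close>

lemma indep_vars_PiM_coordinates: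
  fixes M :: "'a measure"
  assumes "prob_space M"
  shows "prob_space.indep_vars (\<Pi>\<^sub>M k\<in>(UNIV::nat set). M) (\<lambda>_. M) (\<lambda>k x. x k) UNIV"
proof -
  interpret M: prob_space M by fact
  interpret P: prob_space "\<Pi>\<^sub>M k\<in>(UNIV::nat set). M"
    by (rule prob_space_PiM) (rule M.prob_space_axioms)
  have "distr (\<Pi>\<^sub>M k\<in>(UNIV::nat set). M) M (\<lambda>x. x i) = M" for i
    by (rule distr_PiM_component) (auto simp: M.prob_space_axioms)
  then show ?thesis
    by (subst P.indep_vars_iff_distr_eq_PiM) (simp_all add: restrict_UNIV)
qed

lemma nn_integral_PiM_prod:
  fixes M :: "'a measure" and f :: "nat \<Rightarrow> 'a \<Rightarrow> ennreal"
  assumes M: "prob_space M" and f: "\<And>k. f k \<in> borel_measurable M"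
  shows "(\<integral>\<^sup>+x. (\<Prod>k<N. f k (x k)) \<partial>(\<Pi>\<^sub>M k\<in>(UNIV::nat set). M)) = (\<Prod>k<N. \<integral>\<^sup>+y. f k y \<partial>M)"
proof -
  interpret M: prob_space M by fact
  interpret P: prob_space "\<Pi>\<^sub>M k\<in>(UNIV::nat set). M"
    by (rule prob_space_PiM) (rule M.prob_space_axioms)
  have "P.indep_vars (\<lambda>_. borel) (\<lambda>k x. f k (x k)) UNIV"
    by (rule P.indep_vars_compose2[OF indep_vars_PiM_coordinates[OF M]]) (rule f)
  then have "(\<integral>\<^sup>+x. (\<Prod>k<N. f k (x k)) \<partial>(\<Pi>\<^sub>M k\<in>(UNIV::nat set). M))
      = (\<Prod>k<N. \<integral>\<^sup>+x. f k (x k) \<partial>(\<Pi>\<^sub>M k\<in>(UNIV::nat set). M))"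
    by (intro P.indep_vars_nn_integral) (auto intro: P.indep_vars_subset)
  also have "\<dots> = (\<Prod>k<N. \<integral>\<^sup>+y. f k y \<partial>M)"
  proof (intro prod.cong refl)
    fix k
    have "(\<integral>\<^sup>+y. f k y \<partial>M) = (\<integral>\<^sup>+y. f k y \<partial>distr (\<Pi>\<^sub>M k\<in>(UNIV::nat set). M) M (\<lambda>x. x k))"
      by (subst distr_PiM_component) (auto simp: M.prob_space_axioms)
    also have "\<dots> = (\<integral>\<^sup>+x. f k (x k) \<partial>(\<Pi>\<^sub>M k\<in>(UNIV::nat set). M))"
      by (rule nn_integral_distr) (use f in auto)
    finally show "(\<integral>\<^sup>+x. f k (x k) \<partial>(\<Pi>\<^sub>M k\<in>(UNIV::nat set). M)) = (\<integral>\<^sup>+y. f k y \<partial>M)" ..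
  qed
  finally show ?thesis .
qed

section \<open>The annealed law of the static walk\<close>

locale rwre =
  fixes \<alpha> :: "real measure"
  assumes \<alpha>: "real_distribution \<alpha>"
    and \<alpha>_unit: "AE p in \<alpha>. 0 < p \<and> p < 1"
begin

sublocale \<alpha>: real_distribution \<alpha> by (rule \<alpha>)

lemma sets_env_law [measurable_cong]: "sets (env_law \<alpha>) = sets (\<Pi>\<^sub>M x\<in>UNIV. borel)"
  unfolding env_law_def by (intro sets_PiM_cong) auto

lemma space_env_law [simp]: "space (env_law \<alpha>) = UNIV"
  using sets_eq_imp_space_eq[OF sets_env_law] by (simp add: space_PiM)

sublocale env: prob_space "env_law \<alpha>"
  unfolding env_law_def by (rule prob_space_PiM) unfold_locales

lemma path_weight_const_measurable:
  "(\<lambda>\<omega>. path_weight n h (\<lambda>_. \<omega>)) \<in> borel_measurable (env_law \<alpha>)"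
  unfolding path_weight_def by measurable

lemma path_weight_measurable:
  "path_weight n h \<in> borel_measurable (\<Pi>\<^sub>M i\<in>UNIV. env_law \<alpha>)"
proof -
  have [measurable]: "(\<lambda>\<Omega>. \<Omega> i y) \<in> borel_measurable (\<Pi>\<^sub>M i\<in>UNIV. env_law \<alpha>)" for i :: nat and y
  proof (rule measurable_compose[where f="\<lambda>\<Omega>. \<Omega> i" and g="\<lambda>\<omega>. \<omega> y"])
    show "(\<lambda>\<omega>. \<omega> y) \<in> borel_measurable (env_law \<alpha>)"
      by measurable
  qed (rule measurable_component_singleton, simp)
  show ?thesis
    unfolding path_weight_def by measurable
qed

text \<open>Measurability of a kernel is tested on an intersection-stable generator, here the
  cylinders, where it becomes measurability of \<open>path_weight\<close>. The map \<open>f\<close>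
  covers both uses: environment sequences and a single environment frozen in time.\<close>

lemma quenched_law_measurable_gen:
  assumes "\<And>n h. (\<lambda>a. path_weight n h (f a)) \<in> borel_measurable M"
  shows "(\<lambda>a. quenched_law (f a)) \<in> M \<rightarrow>\<^sub>M prob_algebra path_space"
proof (rule measurable_prob_algebra_generated[OF sets_path_space_cylinders Int_stable_cylinders])
  show "infinite (UNIV :: nat set)" by simp
  fix A :: "(nat \<Rightarrow> int) set" assume "A \<in> cylinders UNIV"
  moreover have "emeasure (quenched_law \<Omega>) UNIV = 1" for \<Omega>
    using prob_space.emeasure_space_1[OF prob_space_quenched_law[of \<Omega>]]
      sets_eq_imp_space_eq[OF sets_quenched_law[of \<Omega>]] by simp
  ultimately show "(\<lambda>a. emeasure (quenched_law (f a)) A) \<in> borel_measurable M"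
    using assms by (auto simp: cylinders_def emeasure_quenched_law_cylinder)
qed (auto simp: prob_space_quenched_law)

lemma quenched_law_measurable [measurable]:
  "quenched_law \<in> (\<Pi>\<^sub>M i\<in>UNIV. env_law \<alpha>) \<rightarrow>\<^sub>M prob_algebra path_space"
  by (rule quenched_law_measurable_gen) (rule path_weight_measurable)

lemma quenched_law_const_measurable [measurable]:
  "(\<lambda>\<omega>. quenched_law (\<lambda>_. \<omega>)) \<in> env_law \<alpha> \<rightarrow>\<^sub>M prob_algebra path_space"
  by (rule quenched_law_measurable_gen) (rule path_weight_const_measurable)

lemma env_law_in_prob_algebra: "env_law \<alpha> \<in> space (prob_algebra (env_law \<alpha>))"
  by (simp add: space_prob_algebra env.prob_space_axioms)

lemma sets_rwre_law [measurable_cong, simp]: "sets (rwre_law \<alpha>) = sets path_space"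
  unfolding rwre_law_def by (rule sets_bind'[OF env_law_in_prob_algebra]) measurable

lemma space_rwre_law [simp]: "space (rwre_law \<alpha>) = UNIV"
  using sets_eq_imp_space_eq[OF sets_rwre_law] by simp

sublocale Z: prob_space "rwre_law \<alpha>"
  unfolding rwre_law_def by (rule prob_space_bind'[OF env_law_in_prob_algebra]) measurable

lemma emeasure_rwre_law_cylinder:
  "emeasure (rwre_law \<alpha>) (path_cylinder n h)
    = (if h 0 = 0 then \<integral>\<^sup>+\<omega>. ennreal (path_weight n h (\<lambda>_. \<omega>)) \<partial>env_law \<alpha> else 0)"
  unfolding rwre_law_def
  by (subst emeasure_bind_prob_algebra[OF env_law_in_prob_algebra quenched_law_const_measurable])
     (auto simp: emeasure_quenched_law_cylinder)

lemma env_law_translate: "distr (env_law \<alpha>) (env_law \<alpha>) (\<lambda>\<omega> x. \<omega> (x + c)) = env_law \<alpha>"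
  using distr_PiM_reindex[of UNIV "\<lambda>_. \<alpha>" "\<lambda>x. x + c" UNIV]
  by (simp add: env_law_def \<alpha>.prob_space_axioms inj_def restrict_def)

text \<open>Shifting the path amounts to reading a shifted environment, which has the same law
  because the sites are i.i.d. A block that starts at \<open>h (\<tau> k)\<close> can thus be
  compared with a walk started at 0.\<close>

lemma nn_integral_path_weight_translate:
  "(\<integral>\<^sup>+\<omega>. ennreal (path_weight n (\<lambda>j. h j + c) (\<lambda>_. \<omega>)) \<partial>env_law \<alpha>)
    = (\<integral>\<^sup>+\<omega>. ennreal (path_weight n h (\<lambda>_. \<omega>)) \<partial>env_law \<alpha>)"
proof -
  have "(\<integral>\<^sup>+\<omega>. ennreal (path_weight n h (\<lambda>_. \<omega>)) \<partial>env_law \<alpha>)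
    = (\<integral>\<^sup>+\<omega>. ennreal (path_weight n h (\<lambda>_. \<omega>)) \<partial>distr (env_law \<alpha>) (env_law \<alpha>) (\<lambda>\<omega> x. \<omega> (x + c)))"
    by (simp only: env_law_translate)
  also have "\<dots> = (\<integral>\<^sup>+\<omega>. ennreal (path_weight n h (\<lambda>_ x. \<omega> (x + c))) \<partial>env_law \<alpha>)"
    by (rule nn_integral_distr)
       (use path_weight_const_measurable in \<open>simp_all add: env_law_def measurable_abs_UNIV\<close>)
  finally show ?thesis by (simp add: path_weight_def)
qed

lemma path_weight_nonzero_imp_bound:
  assumes "path_weight n h \<Omega> \<noteq> 0" "h 0 = 0"
  shows "\<bar>h n\<bar> \<le> int n"
proof -
  have "\<bar>h i\<bar> \<le> int i" if "i \<le> n" for i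
    using that
  proof (induction i)
    case (Suc i)
    then have "step_prob (\<Omega> i (h i)) (h (Suc i) - h i) \<noteq> 0"
      using assms by (auto simp: path_weight_def)
    then have "h (Suc i) - h i = 1 \<or> h (Suc i) - h i = -1"
      by (auto simp: step_prob_eq split: if_splits)
    then show ?case using Suc by auto
  qed (simp add: assms)
  then show ?thesis by simp
qed

text \<open>A path outside the cone passes through a cylinder whose weight vanishes in every
  environment, because some step is not of size 1 or the start is not 0.\<close>

lemma AE_rwre_bound: "AE z in rwre_law \<alpha>. \<forall>n. \<bar>z n\<bar> \<le> int n"
proof -
  have "AE z in rwre_law \<alpha>. z \<in> path_cylinder n h \<longrightarrow> \<bar>h n\<bar> \<le> int n" for n h
  proof (cases "\<bar>h n\<bar> \<le> int n")
    case False
    then have "path_weight n h \<Omega> = 0" if "h 0 = 0" for \<Omega>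
      using path_weight_nonzero_imp_bound that by blast
    then have "emeasure (rwre_law \<alpha>) (path_cylinder n h) = 0"
      by (simp add: emeasure_rwre_law_cylinder)
    then have "path_cylinder n h \<in> null_sets (rwre_law \<alpha>)"
      by (auto intro!: null_setsI)
    then show ?thesis by (rule AE_I'[where N = "path_cylinder n h"]) (use False in auto)
  qed simp
  \<comment> \<open>Lists again make the family of cylinders countable, so that the exceptional null
    sets can be united.\<close>
  then have "AE z in rwre_law \<alpha>. \<forall>n (hs :: int list). z \<in> path_cylinder n (\<lambda>i. hs ! i) \<longrightarrow> \<bar>hs ! n\<bar> \<le> int n"
    by (simp add: AE_all_countable)
  then show ?thesis
  proof (eventually_elim, safe)
    fix z :: "nat \<Rightarrow> int" and n
    assume *: "\<forall>n hs. z \<in> path_cylinder n (\<lambda>i. hs ! i) \<longrightarrow> \<bar>hs ! n\<bar> \<le> int n"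
    show "\<bar>z n\<bar> \<le> int n"
      using *[rule_format, of n "map z [0..<Suc n]"]
      by (auto simp: path_cylinder_def less_Suc_eq_le simp del: upt_Suc)
  qed
qed

end

section \<open>Arithmetic of resampling times\<close>

context
  fixes \<tau> :: "nat \<Rightarrow> nat"
  assumes \<tau>: "cooling_rule \<tau>"
begin

lemma cooling_rule_0 [simp]: "\<tau> 0 = 0"
  and cooling_rule_less_iff [simp]: "\<tau> i < \<tau> j \<longleftrightarrow> i < j"
  and cooling_rule_le_iff [simp]: "\<tau> i \<le> \<tau> j \<longleftrightarrow> i \<le> j"
  and cooling_rule_ge: "k \<le> \<tau> k"
  using \<tau> by (auto simp: cooling_rule_def strict_mono_less strict_mono_less_eq strict_mono_imp_increasing)

lemma finite_resamplings: "finite {k. \<tau> k \<le> n}"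
  by (rule finite_subset[of _ "{..n}"]) (auto intro: order_trans[OF cooling_rule_ge])

lemma last_resampling_le: "\<tau> (last_resampling \<tau> n) \<le> n"
  unfolding last_resampling_def using Max_in[OF finite_resamplings, of n]
  by (metis (mono_tags) cooling_rule_0 empty_iff le0 mem_Collect_eq)

lemma last_resampling_eq:
  assumes "\<tau> k \<le> n" "n < \<tau> (Suc k)"
  shows "last_resampling \<tau> n = k"
  unfolding last_resampling_def
proof (rule Max_eqI)
  show "y \<le> k" if "y \<in> {k. \<tau> k \<le> n}" for y
  proof -
    have "\<tau> y < \<tau> (Suc k)"
      using that assms by (auto simp del: cooling_rule_less_iff)
    then show ?thesis by simp
  qed
qed (use assms finite_resamplings in auto)

lemma last_resampling_less: "n < \<tau> (Suc (last_resampling \<tau> n))"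
proof (rule ccontr)
  assume "\<not> ?thesis"
  then have "Suc (last_resampling \<tau> n) \<le> last_resampling \<tau> n"
    unfolding last_resampling_def using finite_resamplings by (intro Max_ge) auto
  then show False by simp
qed

lemma last_resampling_cooling_rule [simp]: "last_resampling \<tau> (\<tau> k) = k"
  by (rule last_resampling_eq) auto

lemma prod_blocks:
  fixes f :: "nat \<Rightarrow> 'a :: comm_monoid_mult"
  shows "(\<Prod>i<\<tau> N. f i) = (\<Prod>k<N. \<Prod>j<\<tau> (Suc k) - \<tau> k. f (\<tau> k + j))"
proof (induction N)
  case (Suc N)
  have split: "{..<\<tau> (Suc N)} = {..<\<tau> N} \<union> {\<tau> N..<\<tau> (Suc N)}"
    using cooling_rule_le_iff[of N "Suc N"] by (auto simp del: cooling_rule_le_iff cooling_rule_less_iff)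
  have "(\<Prod>i<\<tau> (Suc N). f i) = (\<Prod>i<\<tau> N. f i) * (\<Prod>i\<in>{\<tau> N..<\<tau> (Suc N)}. f i)"
    unfolding split by (rule prod.union_disjoint) auto
  also have "(\<Prod>i\<in>{\<tau> N..<\<tau> (Suc N)}. f i) = (\<Prod>j<\<tau> (Suc N) - \<tau> N. f (\<tau> N + j))"
    by (rule prod.reindex_bij_witness[of _ "\<lambda>j. \<tau> N + j" "\<lambda>i. i - \<tau> N"]) auto
  finally show ?case using Suc by simp
qed simp

end

section \<open>The cooled walk as a concatenation of independent walks\<close>

text \<open>A path that ends at a resampling time consists of complete blocks, and
  \<open>last_resampling\<close> equals \<open>k\<close> throughout block \<open>k\<close>. Each
  environment \<open>\<eta> k\<close> thus occurs in exactly one factor.\<close>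

lemma path_weight_blocks:
  assumes \<tau>: "cooling_rule \<tau>"
  shows "path_weight (\<tau> N) h (\<lambda>i. \<eta> (last_resampling \<tau> i))
    = (\<Prod>k<N. path_weight (\<tau> (Suc k) - \<tau> k) (\<lambda>j. h (\<tau> k + j)) (\<lambda>_. \<eta> k))"
  unfolding path_weight_def prod_blocks[OF \<tau>]
proof (intro prod.cong refl)
  fix k j assume "j \<in> {..<\<tau> (Suc k) - \<tau> k}"
  then have "last_resampling \<tau> (\<tau> k + j) = k"
    by (intro last_resampling_eq[OF \<tau>]) auto
  then show "step_prob (\<eta> (last_resampling \<tau> (\<tau> k + j)) (h (\<tau> k + j))) (h (Suc (\<tau> k + j)) - h (\<tau> k + j)) =
       step_prob (\<eta> k (h (\<tau> k + j))) (h (\<tau> k + Suc j) - h (\<tau> k + j))"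
    by simp
qed

text \<open>Walk \<open>k\<close> is run afresh from time 0 for the length of block \<open>k\<close>
  and attached where the previous one stopped. The last summand is the unfinished block.\<close>

definition concat_walks :: "(nat \<Rightarrow> nat) \<Rightarrow> (nat \<Rightarrow> nat \<Rightarrow> int) \<Rightarrow> nat \<Rightarrow> int" where
  "concat_walks \<tau> w n = (\<Sum>k<last_resampling \<tau> n. w k (\<tau> (Suc k) - \<tau> k))
     + w (last_resampling \<tau> n) (n - \<tau> (last_resampling \<tau> n))"

text \<open>This turns a cylinder event into a conjunction over blocks, hence into a product of
  probabilities. Recentring \<open>h\<close> at \<open>\<tau> k\<close> is needed because every walk
  starts at 0. Each block pins both of its ends, so consecutive blocks fit together.\<close>

lemma concat_walks_in_cylinder_iff:
  assumes \<tau>: "cooling_rule \<tau>" and w: "\<And>k. w k 0 = 0" and h: "h 0 = 0"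
  shows "concat_walks \<tau> w \<in> path_cylinder (\<tau> N) h \<longleftrightarrow>
    (\<forall>k<N. w k \<in> path_cylinder (\<tau> (Suc k) - \<tau> k) (\<lambda>j. h (\<tau> k + j) - h (\<tau> k)))"
proof -
  note [simp] = cooling_rule_0[OF \<tau>] cooling_rule_less_iff[OF \<tau>] cooling_rule_le_iff[OF \<tau>]
    last_resampling_cooling_rule[OF \<tau>]
  have at_resampling: "concat_walks \<tau> w (\<tau> k) = (\<Sum>k<k. w k (\<tau> (Suc k) - \<tau> k))" for k
    by (simp add: concat_walks_def w)
  \<comment> \<open>The right end of the block is included: there \<open>last_resampling\<close> has
    already moved on to \<open>Suc k\<close>, but both descriptions agree because
    \<open>w (Suc k) 0 = 0\<close>.\<close>
  have in_block: "concat_walks \<tau> w (\<tau> k + j) = concat_walks \<tau> w (\<tau> k) + w k j"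
    if j: "j \<le> \<tau> (Suc k) - \<tau> k" for k j
  proof (cases "j = \<tau> (Suc k) - \<tau> k")
    case True
    moreover have "\<tau> k \<le> \<tau> (Suc k)" by simp
    ultimately have "\<tau> k + j = \<tau> (Suc k)" by linarith
    then show ?thesis using True by (simp add: at_resampling)
  next
    case False
    then have "last_resampling \<tau> (\<tau> k + j) = k"
      using j by (intro last_resampling_eq[OF \<tau>]) auto
    then show ?thesis by (simp add: concat_walks_def w)
  qed
  show ?thesis
  proof
    assume c: "concat_walks \<tau> w \<in> path_cylinder (\<tau> N) h"
    have "w k j = h (\<tau> k + j) - h (\<tau> k)" if "k < N" "j \<le> \<tau> (Suc k) - \<tau> k" for k j
    proof -
      have "\<tau> (Suc k) \<le> \<tau> N" "\<tau> k \<le> \<tau> (Suc k)" using that by auto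
      then have "\<tau> k + j \<le> \<tau> N" "\<tau> k \<le> \<tau> N" using that by linarith+
      then show ?thesis using in_block[OF that(2)] c by (auto simp: path_cylinder_def)
    qed
    then show "\<forall>k<N. w k \<in> path_cylinder (\<tau> (Suc k) - \<tau> k) (\<lambda>j. h (\<tau> k + j) - h (\<tau> k))"
      by (auto simp: path_cylinder_def)
  next
    assume r: "\<forall>k<N. w k \<in> path_cylinder (\<tau> (Suc k) - \<tau> k) (\<lambda>j. h (\<tau> k + j) - h (\<tau> k))"
    have hk: "concat_walks \<tau> w (\<tau> k) = h (\<tau> k)" if "k \<le> N" for k
      using that
    proof (induction k)
      case (Suc k)
      have "\<tau> k \<le> \<tau> (Suc k)" by simp
      then show ?case
        using Suc r in_block[of "\<tau> (Suc k) - \<tau> k" k] by (auto simp: path_cylinder_def)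
    qed (simp add: at_resampling[of 0, simplified] h)
    show "concat_walks \<tau> w \<in> path_cylinder (\<tau> N) h"
      unfolding path_cylinder_def
    proof safe
      fix i assume i: "i \<le> \<tau> N"
      define k where "k = last_resampling \<tau> i"
      have k: "\<tau> k \<le> i" "i < \<tau> (Suc k)"
        using last_resampling_le[OF \<tau>] last_resampling_less[OF \<tau>] by (auto simp: k_def)
      show "concat_walks \<tau> w i = h i"
      proof (cases "i = \<tau> N")
        case False
        then have "\<tau> k < \<tau> N" using k i by linarith
        then have "k < N" by simp
        then show ?thesis
          using hk[of k] in_block[of "i - \<tau> k" k] k r by (auto simp: path_cylinder_def)
      qed (use hk in simp)
    qed
  qed
qed

lemma concat_walks_measurable:
  assumes M: "sets M = sets path_space"
  shows "concat_walks \<tau> \<in> (\<Pi>\<^sub>M k\<in>UNIV. M) \<rightarrow>\<^sub>M path_space"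
proof -
  note [measurable_cong] = M
  let ?P = "\<Pi>\<^sub>M k\<in>UNIV. M"
  have component: "(\<lambda>w. w k j) \<in> ?P \<rightarrow>\<^sub>M count_space UNIV" for k j :: nat
  proof (rule measurable_compose[where f="\<lambda>w. w k" and g="\<lambda>z. z j"])
    show "(\<lambda>z. z j) \<in> M \<rightarrow>\<^sub>M count_space (UNIV :: int set)" by measurable
  qed (rule measurable_component_singleton, simp)
  \<comment> \<open>The target is \<open>count_space\<close> on a countable type, so the sum is
    split over the values of the first summand.\<close>
  have add: "(\<lambda>w. f w + g w) \<in> ?P \<rightarrow>\<^sub>M count_space UNIV"
    if "f \<in> ?P \<rightarrow>\<^sub>M count_space UNIV" "g \<in> ?P \<rightarrow>\<^sub>M count_space UNIV" for f g :: "_ \<Rightarrow> int"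
    by (rule measurable_compose_countable[where f="\<lambda>i w. i + g w", OF _ that(1)])
       (rule measurable_compose[OF that(2)], simp)
  have sum: "(\<lambda>w. \<Sum>k<m. w k (l k)) \<in> ?P \<rightarrow>\<^sub>M count_space UNIV" for m and l :: "nat \<Rightarrow> nat"
    by (induction m) (simp_all add: add component)
  show ?thesis
    unfolding concat_walks_def[abs_def] by (intro measurable_abs_UNIV add sum component)
qed

section \<open>The annealed law of the cooled walk\<close>

context rwre begin

lemma sets_cooling_env_law [measurable_cong, simp]:
  "sets (cooling_env_law \<alpha> \<tau>) = sets (\<Pi>\<^sub>M n\<in>UNIV. env_law \<alpha>)"
  by (simp add: cooling_env_law_def)

lemma cooling_env_measurable:
  "(\<lambda>\<eta> n. \<eta> (last_resampling \<tau> n)) \<in> (\<Pi>\<^sub>M k\<in>UNIV. env_law \<alpha>) \<rightarrow>\<^sub>M (\<Pi>\<^sub>M n\<in>UNIV. env_law \<alpha>)"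
  by (rule measurable_abs_UNIV) simp

lemma cooling_env_law_in_prob_algebra:
  "cooling_env_law \<alpha> \<tau> \<in> space (prob_algebra (\<Pi>\<^sub>M n\<in>UNIV. env_law \<alpha>))"
proof -
  interpret P: prob_space "\<Pi>\<^sub>M n\<in>(UNIV::nat set). env_law \<alpha>"
    by (rule prob_space_PiM) (rule env.prob_space_axioms)
  have "prob_space (cooling_env_law \<alpha> \<tau>)"
    unfolding cooling_env_law_def by (rule P.prob_space_distr) (rule cooling_env_measurable)
  then show ?thesis
    by (simp add: space_prob_algebra)
qed

lemma sets_rwcre_law [measurable_cong, simp]: "sets (rwcre_law \<alpha> \<tau>) = sets path_space"
  unfolding rwcre_law_def by (rule sets_bind'[OF cooling_env_law_in_prob_algebra]) measurable

lemma prob_space_rwcre_law: "prob_space (rwcre_law \<alpha> \<tau>)"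
  unfolding rwcre_law_def by (rule prob_space_bind'[OF cooling_env_law_in_prob_algebra]) measurable

text \<open>After \<open>path_weight_blocks\<close> the integrand is a product of functions of
  different, independent environments, so the integral factorises.\<close>

lemma emeasure_rwcre_law_cylinder:
  assumes \<tau>: "cooling_rule \<tau>"
  shows "emeasure (rwcre_law \<alpha> \<tau>) (path_cylinder (\<tau> N) h) = (if h 0 = 0 then
    (\<Prod>k<N. \<integral>\<^sup>+\<omega>. ennreal (path_weight (\<tau> (Suc k) - \<tau> k) (\<lambda>j. h (\<tau> k + j)) (\<lambda>_. \<omega>)) \<partial>env_law \<alpha>) else 0)"
proof -
  have "emeasure (rwcre_law \<alpha> \<tau>) (path_cylinder (\<tau> N) h)
     = (\<integral>\<^sup>+\<Omega>. emeasure (quenched_law \<Omega>) (path_cylinder (\<tau> N) h) \<partial>cooling_env_law \<alpha> \<tau>)"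
    unfolding rwcre_law_def
    by (rule emeasure_bind_prob_algebra[OF cooling_env_law_in_prob_algebra quenched_law_measurable]) simp
  also have "\<dots> = (if h 0 = 0 then (\<integral>\<^sup>+\<Omega>. ennreal (path_weight (\<tau> N) h \<Omega>) \<partial>cooling_env_law \<alpha> \<tau>) else 0)"
    by (simp add: emeasure_quenched_law_cylinder)
  also have "(\<integral>\<^sup>+\<Omega>. ennreal (path_weight (\<tau> N) h \<Omega>) \<partial>cooling_env_law \<alpha> \<tau>)
     = (\<integral>\<^sup>+\<eta>. ennreal (path_weight (\<tau> N) h (\<lambda>i. \<eta> (last_resampling \<tau> i))) \<partial>(\<Pi>\<^sub>M k\<in>UNIV. env_law \<alpha>))"
    unfolding cooling_env_law_def by (rule nn_integral_distr[OF cooling_env_measurable]) (use path_weight_measurable in measurable)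
  also have "\<dots> = (\<integral>\<^sup>+\<eta>. (\<Prod>k<N. ennreal (path_weight (\<tau> (Suc k) - \<tau> k) (\<lambda>j. h (\<tau> k + j)) (\<lambda>_. \<eta> k)))
       \<partial>(\<Pi>\<^sub>M k\<in>UNIV. env_law \<alpha>))"
    unfolding path_weight_blocks[OF \<tau>]
    by (intro nn_integral_cong prod_ennreal[symmetric]) (simp add: path_weight_def prod_nonneg)
  also have "\<dots> = (\<Prod>k<N. \<integral>\<^sup>+\<omega>. ennreal (path_weight (\<tau> (Suc k) - \<tau> k) (\<lambda>j. h (\<tau> k + j)) (\<lambda>_. \<omega>)) \<partial>env_law \<alpha>)"
    by (rule nn_integral_PiM_prod[OF env.prob_space_axioms,
          where f="\<lambda>k \<omega>. ennreal (path_weight (\<tau> (Suc k) - \<tau> k) (\<lambda>j. h (\<tau> k + j)) (\<lambda>_. \<omega>))"])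
       (rule measurable_compose[OF path_weight_const_measurable measurable_ennreal])
  finally show ?thesis .
qed

abbreviation walks_law :: "(nat \<Rightarrow> nat \<Rightarrow> int) measure" where
  "walks_law \<equiv> \<Pi>\<^sub>M k\<in>UNIV. rwre_law \<alpha>"

sublocale W: prob_space walks_law
  by (rule prob_space_PiM) (rule Z.prob_space_axioms)

lemma AE_walks_bound: "AE w in walks_law. \<forall>k n. \<bar>w k n\<bar> \<le> int n"
  unfolding AE_all_countable
  using AE_rwre_bound by (auto intro!: AE_PiM_component simp: Z.prob_space_axioms AE_all_countable)

text \<open>On cylinders with end time in \<open>range \<tau>\<close> both laws are products over
  blocks: on the left by independence of the environments, on the right by independence of the
  walks. Corresponding factors differ only by the translation by
  \<open>h (\<tau> k)\<close>.\<close>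

theorem rwcre_law_eq_distr_concat_walks:
  assumes \<tau>: "cooling_rule \<tau>"
  shows "rwcre_law \<alpha> \<tau> = distr walks_law path_space (concat_walks \<tau>)"
proof (rule path_law_eqI[where S="range \<tau>"])
  have cm: "concat_walks \<tau> \<in> walks_law \<rightarrow>\<^sub>M path_space"
    by (rule concat_walks_measurable) simp
  show "prob_space (distr walks_law path_space (concat_walks \<tau>))"
    by (rule W.prob_space_distr[OF cm])
  show "infinite (range \<tau>)"
    using \<tau> by (auto simp: cooling_rule_def strict_mono_imp_inj_on range_inj_infinite)
  fix n h assume "n \<in> range \<tau>"
  then obtain N where n: "n = \<tau> N" by auto
  let ?C = "\<lambda>k. path_cylinder (\<tau> (Suc k) - \<tau> k) (\<lambda>j. h (\<tau> k + j) - h (\<tau> k))"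
  have *: "emeasure (distr walks_law path_space (concat_walks \<tau>)) (path_cylinder n h)
     = emeasure walks_law {w \<in> space walks_law. concat_walks \<tau> w \<in> path_cylinder n h}"
    by (subst emeasure_distr[OF cm]) (auto intro!: arg_cong2[where f=emeasure])
  have zero: "concat_walks \<tau> w 0 = 0" if "\<And>k. w k 0 = 0" for w
    using last_resampling_cooling_rule[OF \<tau>, of 0] that
    by (simp add: concat_walks_def cooling_rule_0[OF \<tau>])
  \<comment> \<open>The walks start at 0 only almost surely, so the two events below are identified
    up to a null set.\<close>
  have AE0: "AE w in walks_law. \<forall>k. w k 0 = 0"
    using AE_walks_bound by eventually_elim (metis abs_le_zero_iff of_nat_0)
  show "emeasure (rwcre_law \<alpha> \<tau>) (path_cylinder n h)
      = emeasure (distr walks_law path_space (concat_walks \<tau>)) (path_cylinder n h)"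
  proof (cases "h 0 = 0")
    case True
    interpret prod: product_prob_space "\<lambda>_. rwre_law \<alpha>" "UNIV :: nat set"
      by unfold_locales
    have "emeasure walks_law {w \<in> space walks_law. concat_walks \<tau> w \<in> path_cylinder n h}
       = emeasure walks_law {w \<in> space walks_law. \<forall>k\<in>{..<N}. w k \<in> ?C k}"
    proof (rule emeasure_eq_AE)
      show "AE w in walks_law. (w \<in> {w \<in> space walks_law. concat_walks \<tau> w \<in> path_cylinder n h})
        = (w \<in> {w \<in> space walks_law. \<forall>k\<in>{..<N}. w k \<in> ?C k})"
        using AE0 by eventually_elim (simp add: n concat_walks_in_cylinder_iff[where h=h, OF \<tau> _ True] Ball_def)
      show "{w \<in> space walks_law. concat_walks \<tau> w \<in> path_cylinder n h} \<in> sets walks_law"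
        using measurable_sets[OF cm sets_path_cylinder[of n h]] by (simp add: vimage_def Int_def conj_commute)
      show "{w \<in> space walks_law. \<forall>k\<in>{..<N}. w k \<in> ?C k} \<in> sets walks_law"
        by measurable
    qed
    also have "\<dots> = (\<Prod>k<N. emeasure (rwre_law \<alpha>) (?C k))"
      by (rule prod.emeasure_PiM_Collect) auto
    also have "\<dots> = (\<Prod>k<N. \<integral>\<^sup>+\<omega>. ennreal (path_weight (\<tau> (Suc k) - \<tau> k) (\<lambda>j. h (\<tau> k + j)) (\<lambda>_. \<omega>)) \<partial>env_law \<alpha>)"
      by (intro prod.cong refl)
         (simp add: emeasure_rwre_law_cylinder nn_integral_path_weight_translate[where c="- h (\<tau> _)", simplified])
    finally show ?thesis
      unfolding *[unfolded n] n
      by (simp add: emeasure_rwcre_law_cylinder[OF \<tau>] True n)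
  next
    case False
    have "emeasure walks_law {w \<in> space walks_law. concat_walks \<tau> w \<in> path_cylinder n h} = 0"
    proof (rule emeasure_eq_0_AE)
      show "AE w in walks_law. \<not> concat_walks \<tau> w \<in> path_cylinder n h"
        using AE0 by eventually_elim (use zero False in \<open>auto simp: path_cylinder_def\<close>)
    qed
    then show ?thesis
      unfolding *[unfolded n] n by (simp add: emeasure_rwcre_law_cylinder[OF \<tau>] False)
  qed
qed (auto simp: prob_space_rwcre_law)

end

section \<open>Limit theorems for bounded independent variables\<close>

lemma (in prob_space) bounded_strong_law:
  fixes X :: "nat \<Rightarrow> 'a \<Rightarrow> real"
  assumes indep: "indep_vars (\<lambda>_. borel) X UNIV"
    and bound: "\<And>k. AE x in M. \<bar>X k x\<bar> \<le> B"
  shows "AE x in M. (\<lambda>n. (\<Sum>k<n. X k x - expectation (X k)) / real n) \<longlonglongrightarrow> 0"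
proof -
  \<comment> \<open>The maximum makes the width of the Hoeffding intervals positive, whatever the
    sign of \<open>B\<close>.\<close>
  define D where "D = max B 1"
  have D: "D > 0" by (simp add: D_def)
  have rv [measurable]: "random_variable borel (X k)" for k
    using indep by (auto simp: indep_vars_def)
  define S where "S n x = (\<Sum>k<n. X k x - expectation (X k))" for n x
  have S_measurable [measurable]: "S n \<in> borel_measurable M" for n
    unfolding S_def by measurable
  have ev: "AE x in M. eventually (\<lambda>n. \<bar>S (Suc n) x\<bar> < e * real (Suc n)) sequentially" if e: "e > 0" for e
  proof -
    \<comment> \<open>\<open>Suc n\<close> keeps the number of summands positive. For
      \<open>m\<close> variables with values in an interval of width \<open>2 * D\<close>,
      Hoeffding's exponent at deviation \<open>e * m\<close> is minus \<open>m * c\<close>, with the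
      \<open>c\<close> defined next; the resulting geometric bound is summable.\<close>
    define A where "A n = {x\<in>space M. \<bar>S (Suc n) x\<bar> \<ge> e * real (Suc n)}" for n
    define c where "c = e\<^sup>2 / (2 * D\<^sup>2)"
    have c: "c > 0" using e D by (simp add: c_def)
    have A_sets [measurable]: "A n \<in> sets M" for n
      unfolding A_def by measurable
    have A_le: "prob (A n) \<le> 2 * exp (- c) ^ n" for n
    proof -
      interpret H: Hoeffding_ineq M "{..<Suc n}" X "\<lambda>_. - D" "\<lambda>_. D" "\<Sum>k<Suc n. expectation (X k)"
      proof unfold_locales
        show "AE x in M. X i x \<in> {- D..D}" for i
          using bound[of i] by eventually_elim (auto simp: D_def)
      qed (use indep_vars_subset[OF indep] in auto)
      have "(\<Sum>i<Suc n. (D - - D)\<^sup>2) = real (Suc n) * (4 * D\<^sup>2)"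
        by (simp add: power2_eq_square algebra_simps)
      moreover have "A n = {x\<in>space M. \<bar>(\<Sum>i<Suc n. X i x) - (\<Sum>k<Suc n. expectation (X k))\<bar> \<ge> e * real (Suc n)}"
        unfolding A_def S_def by (simp only: sum_subtractf)
      ultimately have "prob (A n) \<le> 2 * exp (- 2 * (e * real (Suc n))\<^sup>2 / (real (Suc n) * (4 * D\<^sup>2)))"
        using H.Hoeffding_ineq_abs_ge[of "e * real (Suc n)"] e D by simp
      also have "- 2 * (e * real (Suc n))\<^sup>2 / (real (Suc n) * (4 * D\<^sup>2)) = real (Suc n) * (- c)"
      proof -
        have "- 2 * (e * m)\<^sup>2 / (m * (4 * D\<^sup>2)) = m * (- c)" if "m > 0" for m
          using D that by (simp add: c_def field_simps power2_eq_square)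
        then show ?thesis by simp
      qed
      also have "2 * exp (real (Suc n) * (- c)) \<le> 2 * exp (real n * (- c))"
        using c by (simp add: mult_right_mono)
      also have "exp (real n * (- c)) = exp (- c) ^ n"
        by (rule exp_of_nat_mult)
      finally show ?thesis .
    qed
    have "summable (\<lambda>n. prob (A n))"
    proof (rule summable_comparison_test')
      show "summable (\<lambda>n. 2 * exp (- c) ^ n)"
        using c by (intro summable_mult summable_geometric) auto
      show "norm (prob (A n)) \<le> 2 * exp (- c) ^ n" for n
        using A_le by simp
    qed
    then have "AE x in M. eventually (\<lambda>n. x \<in> space M - A n) sequentially"
      by (intro borel_cantelli_AE1) (auto simp: emeasure_eq_measure)
    then show ?thesis
      by eventually_elim (auto simp: A_def elim!: eventually_mono)
  qed
  \<comment> \<open>Countably many tolerances suffice, which leaves a single null set.\<close>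
  have "AE x in M. \<forall>m. eventually (\<lambda>n. \<bar>S (Suc n) x\<bar> < inverse (real (Suc m)) * real (Suc n)) sequentially"
    unfolding AE_all_countable by (intro allI ev) simp
  then show ?thesis
  proof eventually_elim
    fix x assume *: "\<forall>m. eventually (\<lambda>n. \<bar>S (Suc n) x\<bar> < inverse (real (Suc m)) * real (Suc n)) sequentially"
    have "(\<lambda>n. S (Suc n) x / real (Suc n)) \<longlonglongrightarrow> 0"
    proof (rule tendstoI)
      fix e :: real assume "e > 0"
      then obtain m where m: "inverse (real (Suc m)) < e"
        using reals_Archimedean by blast
      from * have "eventually (\<lambda>n. \<bar>S (Suc n) x\<bar> < inverse (real (Suc m)) * real (Suc n)) sequentially" by blast
      then show "eventually (\<lambda>n. dist (S (Suc n) x / real (Suc n)) 0 < e) sequentially"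
      proof eventually_elim
        case (elim n)
        then have "\<bar>S (Suc n) x\<bar> / real (Suc n) < inverse (real (Suc m))"
          by (subst pos_divide_less_eq) auto
        then show ?case using m by simp
      qed
    qed
    then have "(\<lambda>n. S n x / real n) \<longlonglongrightarrow> 0"
      by (subst (asm) filterlim_sequentially_Suc[where f="\<lambda>n. S n x / real n"])
    then show "(\<lambda>n. (\<Sum>k<n. X k x - expectation (X k)) / real n) \<longlonglongrightarrow> 0"
      by (simp add: S_def)
  qed
qed

section \<open>Characteristic functions and a central limit theorem\<close>

lemma exp_minus_linear_error:
  fixes y :: real
  assumes "0 \<le> y"
  shows "\<bar>exp (- y) - (1 - y)\<bar> \<le> y\<^sup>2 / 2"
proof -
  have q: "1 + y + y\<^sup>2 / 2 \<le> exp y"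
    by (rule exp_lower_Taylor_quadratic) fact
  \<comment> \<open>The product equals \<open>1 + y^4 / 4\<close>; dividing the chain by
    \<open>exp y\<close> then bounds \<open>exp (- y)\<close> from above.\<close>
  have "1 \<le> (1 - y + y\<^sup>2 / 2) * (1 + y + y\<^sup>2 / 2)"
    using assms by (simp add: power2_eq_square algebra_simps)
  also have "\<dots> \<le> (1 - y + y\<^sup>2 / 2) * exp y"
  proof (rule mult_left_mono[OF q])
    have "0 \<le> (y - 1)\<^sup>2 + 1" by simp
    then show "0 \<le> 1 - y + y\<^sup>2 / 2" by (simp add: power2_eq_square algebra_simps)
  qed
  finally have "exp (- y) \<le> 1 - y + y\<^sup>2 / 2"
    by (simp add: exp_minus field_simps)
  moreover have "1 - y \<le> exp (- y)"
    using exp_ge_add_one_self[of "- y"] by simp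
  ultimately show ?thesis by simp
qed

text \<open>Both the variable and the Gaussian of the same variance are compared with
  \<open>1 - t^2 * V / 2\<close>. The form of the bound matters: it is proportional to the variance,
  so summing over many summands gives the total variance times a factor that vanishes with
  \<open>b\<close>.\<close>

lemma (in prob_space) char_bounded_centered:
  fixes X :: "'a \<Rightarrow> real"
  assumes rv [measurable]: "random_variable borel X" and bound: "AE x in M. \<bar>X x\<bar> \<le> b"
    and mean: "expectation X = 0"
  shows "cmod (char (distr M borel X) t - exp (- (t\<^sup>2 * variance X / 2)))
    \<le> t\<^sup>2 * variance X * (\<bar>t\<bar> * b + (t * b)\<^sup>2)"
proof -
  define V where "V = expectation (\<lambda>x. (X x)\<^sup>2)"
  have V: "variance X = V" by (simp add: V_def mean)
  have b: "0 \<le> b"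
  proof -
    have "AE x in M. 0 \<le> b" using bound by eventually_elim auto
    then show ?thesis by simp
  qed
  have int1: "integrable M X"
    using bound by (intro integrable_const_bound[where B=b]) auto
  have sq: "AE x in M. (X x)\<^sup>2 \<le> b\<^sup>2"
    using bound by eventually_elim (metis abs_ge_zero power2_abs power_mono)
  have int2: "integrable M (\<lambda>x. (X x)\<^sup>2)"
    using sq by (intro integrable_const_bound[where B="b\<^sup>2"]) auto
  have V_nonneg: "0 \<le> V" by (simp add: V_def)
  \<comment> \<open>This is what turns the error of order \<open>V^2\<close> on the Gaussian side
    into \<open>b^2\<close> times \<open>V\<close>.\<close>
  have V_le: "V \<le> b\<^sup>2"
  proof -
    have "V \<le> expectation (\<lambda>x. b\<^sup>2)"
      unfolding V_def using sq int2 by (intro integral_mono_AE) auto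
    then show ?thesis by (simp add: prob_space)
  qed
  have "cmod (char (distr M borel X) t - (1 - t\<^sup>2 * V / 2))
      \<le> t\<^sup>2 / 6 * expectation (\<lambda>x. min (6 * (X x)\<^sup>2) (\<bar>t\<bar> * \<bar>X x\<bar> ^ 3))"
    by (rule char_approx3') (use int1 int2 mean V in auto)
  also have "expectation (\<lambda>x. min (6 * (X x)\<^sup>2) (\<bar>t\<bar> * \<bar>X x\<bar> ^ 3)) \<le> expectation (\<lambda>x. \<bar>t\<bar> * b * (X x)\<^sup>2)"
  proof (rule integral_mono_AE)
    show "AE x in M. min (6 * (X x)\<^sup>2) (\<bar>t\<bar> * \<bar>X x\<bar> ^ 3) \<le> \<bar>t\<bar> * b * (X x)\<^sup>2"
      using bound
    proof eventually_elim
      case (elim x)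
      have "\<bar>X x\<bar> ^ 3 = \<bar>X x\<bar> * (X x)\<^sup>2"
        by (simp add: power3_eq_cube power2_eq_square)
      also have "\<dots> \<le> b * (X x)\<^sup>2"
        using elim by (intro mult_right_mono) auto
      finally have "\<bar>t\<bar> * \<bar>X x\<bar> ^ 3 \<le> \<bar>t\<bar> * (b * (X x)\<^sup>2)"
        by (rule mult_left_mono) simp
      then show ?case by (simp add: min_le_iff_disj mult.assoc)
    qed
    show "integrable M (\<lambda>x. min (6 * (X x)\<^sup>2) (\<bar>t\<bar> * \<bar>X x\<bar> ^ 3))"
      by (rule Bochner_Integration.integrable_bound[where f="\<lambda>x. 6 * (X x)\<^sup>2"]) (use int2 in \<open>auto\<close>)
  qed (use int2 in auto)
  also have "\<dots> = \<bar>t\<bar> * b * V" by (simp add: V_def)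
  finally have 1: "cmod (char (distr M borel X) t - (1 - t\<^sup>2 * V / 2)) \<le> t\<^sup>2 / 6 * (\<bar>t\<bar> * b * V)"
    by (simp add: mult_left_mono)
  have "\<bar>exp (- (t\<^sup>2 * V / 2)) - (1 - t\<^sup>2 * V / 2)\<bar> \<le> (t\<^sup>2 * V / 2)\<^sup>2 / 2"
    by (rule exp_minus_linear_error) (use V_nonneg in simp)
  then have 2: "cmod ((1 - t\<^sup>2 * V / 2) - exp (- (t\<^sup>2 * V / 2))) \<le> (t\<^sup>2 * V / 2)\<^sup>2 / 2"
    by (metis abs_minus_commute norm_of_real of_real_diff of_real_1 of_real_mult of_real_divide of_real_numeral of_real_power)
  have "cmod (char (distr M borel X) t - exp (- (t\<^sup>2 * V / 2)))
      \<le> t\<^sup>2 / 6 * (\<bar>t\<bar> * b * V) + (t\<^sup>2 * V / 2)\<^sup>2 / 2"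
    using norm_triangle_ineq[of "char (distr M borel X) t - (1 - t\<^sup>2 * V / 2)" "(1 - t\<^sup>2 * V / 2) - exp (- (t\<^sup>2 * V / 2))"] 1 2
    by simp
  also have "t\<^sup>2 / 6 * (\<bar>t\<bar> * b * V) \<le> t\<^sup>2 * V * (\<bar>t\<bar> * b)"
    using b V_nonneg by (simp add: mult_ac)
  also have "(t\<^sup>2 * V / 2)\<^sup>2 / 2 \<le> t\<^sup>2 * V * (t * b)\<^sup>2"
  proof -
    have "(t\<^sup>2 * V / 2)\<^sup>2 / 2 = (t\<^sup>2 * V * t\<^sup>2) * V / 8"
      by (simp add: power2_eq_square)
    also have "\<dots> \<le> (t\<^sup>2 * V * t\<^sup>2) * V"
      using V_nonneg by simp
    also have "\<dots> \<le> (t\<^sup>2 * V * t\<^sup>2) * b\<^sup>2"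
      by (rule mult_left_mono[OF V_le]) (use V_nonneg in simp)
    finally show ?thesis by (simp add: power_mult_distrib mult_ac)
  qed
  finally show ?thesis by (simp add: V ring_distribs)
qed

lemma (in prob_space) char_distr_diff_le:
  fixes F G :: "'a \<Rightarrow> real"
  assumes [measurable]: "random_variable borel F" "random_variable borel G"
    and close: "AE x in M. \<bar>F x - G x\<bar> \<le> r"
  shows "cmod (char (distr M borel F) t - char (distr M borel G) t) \<le> \<bar>t\<bar> * r"
proof -
  have int: "integrable M (\<lambda>x. iexp (t * F x))" "integrable M (\<lambda>x. iexp (t * G x))"
    by (intro integrable_iexp; simp)+
  have "char (distr M borel F) t - char (distr M borel G) t = (CLINT x|M. iexp (t * F x) - iexp (t * G x))"
    using int by (simp add: char_def integral_distr)
  also have "cmod \<dots> \<le> (LINT x|M. cmod (iexp (t * F x) - iexp (t * G x)))"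
    by (rule integral_norm_bound)
  also have "\<dots> \<le> (LINT x|M. \<bar>t\<bar> * r)"
  proof (rule integral_mono_AE)
    show "AE x in M. cmod (iexp (t * F x) - iexp (t * G x)) \<le> \<bar>t\<bar> * r"
      using close
    proof eventually_elim
      case (elim x)
      have "iexp (t * F x) - iexp (t * G x) = iexp (t * G x) * (iexp (t * (F x - G x)) - 1)"
        by (simp add: algebra_simps flip: exp_add)
      then have "cmod (iexp (t * F x) - iexp (t * G x)) = cmod (iexp (t * (F x - G x)) - 1)"
        by (simp add: norm_mult del: of_real_mult of_real_diff)
      also have "\<dots> \<le> \<bar>t * (F x - G x)\<bar>"
        using iexp_approx1[of "t * (F x - G x)" 0] by simp
      also have "\<dots> \<le> \<bar>t\<bar> * r"
        using elim by (simp add: abs_mult mult_left_mono)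
      finally show ?case .
    qed
  qed (use int in auto)
  finally show ?thesis by (simp add: prob_space)
qed

text \<open>By Levy's continuity theorem, the product of the characteristic functions is compared
  with a product of Gaussian ones; since all factors have modulus at most 1, the difference is at
  most the sum of the differences of the factors. The uniform smallness in \<open>small\<close>
  takes the place of Lindeberg's condition. The variable \<open>F n\<close> need only be near the
  normalised sum, which leaves room for an unfinished block and an inexact centering.\<close>

theorem (in prob_space) small_summands_central_limit:
  fixes Y :: "nat \<Rightarrow> 'a \<Rightarrow> real" and F :: "nat \<Rightarrow> 'a \<Rightarrow> real" and N :: "nat \<Rightarrow> nat"
    and c s r :: "nat \<Rightarrow> real"
  assumes indep: "indep_vars (\<lambda>_. borel) Y UNIV"
    and mean: "\<And>k. expectation (Y k) = 0"
    and bound: "\<And>k. AE x in M. \<bar>Y k x\<bar> \<le> c k"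
    and s: "eventually (\<lambda>n. s n > 0) sequentially"
    and small: "\<And>e. e > 0 \<Longrightarrow> eventually (\<lambda>n. \<forall>k<N n. c k \<le> e * s n) sequentially"
    and var: "(\<lambda>n. (\<Sum>k<N n. variance (Y k)) / (s n)\<^sup>2) \<longlonglongrightarrow> 1"
    and F [measurable]: "\<And>n. random_variable borel (F n)"
    and close: "eventually (\<lambda>n. AE x in M. \<bar>F n x - (\<Sum>k<N n. Y k x) / s n\<bar> \<le> r n) sequentially"
    and r: "r \<longlonglongrightarrow> 0"
  shows "weak_conv_m (\<lambda>n. distr M borel (F n)) std_normal_distribution"
proof (rule levy_continuity)
  have rv [measurable]: "random_variable borel (Y k)" for k
    using indep by (auto simp: indep_vars_def)
  show "real_distribution (distr M borel (F n))" for n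
    by (rule real_distribution_distr) measurable
  show "real_distribution std_normal_distribution"
    by (rule real_dist_normal_dist)
  fix t :: real
  define v where "v n = (\<Sum>k<N n. variance (Y k)) / (s n)\<^sup>2" for n
  define G where "G n x = (\<Sum>k<N n. Y k x / s n)" for n x
  have G_measurable [measurable]: "random_variable borel (G n)" for n
    unfolding G_def by measurable
  have main: "eventually (\<lambda>n. cmod (char (distr M borel (G n)) t - exp (- (t\<^sup>2 * v n / 2)))
      \<le> t\<^sup>2 * v n * (\<bar>t\<bar> * e + (t * e)\<^sup>2)) sequentially" if e: "e > 0" for e
    using s small[OF e]
  proof eventually_elim
    case (elim n)
    have indep': "indep_vars (\<lambda>_. borel) (\<lambda>k x. Y k x / s n) {..<N n}"
      by (rule indep_vars_compose2[OF indep_vars_subset[OF indep subset_UNIV]]) measurable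
    have char_G: "char (distr M borel (G n)) t = (\<Prod>k<N n. char (distr M borel (\<lambda>x. Y k x / s n)) t)"
      unfolding G_def by (rule char_distr_sum[OF indep'])
    have var_s: "variance (\<lambda>x. Y k x / s n) = variance (Y k) / (s n)\<^sup>2" for k
      by (simp add: mean power_divide)
    have exp_v: "complex_of_real (exp (- (t\<^sup>2 * v n / 2)))
        = (\<Prod>k<N n. complex_of_real (exp (- (t\<^sup>2 * variance (\<lambda>x. Y k x / s n) / 2))))"
    proof -
      have "- (t\<^sup>2 * v n / 2) = (\<Sum>k<N n. - (t\<^sup>2 * variance (\<lambda>x. Y k x / s n) / 2))"
        unfolding var_s v_def by (simp add: sum_negf sum_distrib_left sum_divide_distrib)
      then show ?thesis by (simp only: exp_sum[OF finite_lessThan] of_real_prod)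
    qed
    have "cmod (char (distr M borel (G n)) t - exp (- (t\<^sup>2 * v n / 2)))
      \<le> (\<Sum>k<N n. cmod (char (distr M borel (\<lambda>x. Y k x / s n)) t - exp (- (t\<^sup>2 * variance (\<lambda>x. Y k x / s n) / 2))))"
      unfolding char_G exp_v
    proof (rule norm_prod_diff)
      fix k
      interpret D: real_distribution "distr M borel (\<lambda>x. Y k x / s n)"
        by (rule real_distribution_distr) measurable
      show "cmod (char (distr M borel (\<lambda>x. Y k x / s n)) t) \<le> 1"
        by (rule D.cmod_char_le_1)
      show "cmod (complex_of_real (exp (- (t\<^sup>2 * variance (\<lambda>x. Y k x / s n) / 2)))) \<le> 1"
        by (simp add: variance_positive)
    qed
    also have "\<dots> \<le> (\<Sum>k<N n. t\<^sup>2 * variance (\<lambda>x. Y k x / s n) * (\<bar>t\<bar> * e + (t * e)\<^sup>2))"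
    proof (rule sum_mono)
      fix k assume k: "k \<in> {..<N n}"
      show "cmod (char (distr M borel (\<lambda>x. Y k x / s n)) t - exp (- (t\<^sup>2 * variance (\<lambda>x. Y k x / s n) / 2)))
         \<le> t\<^sup>2 * variance (\<lambda>x. Y k x / s n) * (\<bar>t\<bar> * e + (t * e)\<^sup>2)"
      proof (rule char_bounded_centered)
        show "AE x in M. \<bar>Y k x / s n\<bar> \<le> e"
          using bound[of k]
        proof eventually_elim
          fix x assume "\<bar>Y k x\<bar> \<le> c k"
          also have "c k \<le> e * s n" using elim k by auto
          finally show "\<bar>Y k x / s n\<bar> \<le> e"
            using elim(1) by (simp add: pos_divide_le_eq)
        qed
      qed (simp_all add: mean)
    qed
    also have "\<dots> = t\<^sup>2 * v n * (\<bar>t\<bar> * e + (t * e)\<^sup>2)"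
      unfolding var_s v_def
      by (simp only: sum_distrib_left[symmetric] sum_distrib_right[symmetric] sum_divide_distrib[symmetric])
    finally show ?case .
  qed
  have lim_exp: "(\<lambda>n. complex_of_real (exp (- (t\<^sup>2 * v n / 2)))) \<longlonglongrightarrow> exp (- (t\<^sup>2 * 1 / 2))"
    by (intro tendsto_intros) (use var in \<open>simp_all add: v_def\<close>)
  have "(\<lambda>n. char (distr M borel (G n)) t - exp (- (t\<^sup>2 * v n / 2))) \<longlonglongrightarrow> 0"
  proof (rule tendstoI)
    fix d :: real assume d: "d > 0"
    \<comment> \<open>The factor 2 is an eventual upper bound for \<open>v n\<close>, which tends to
      1; \<open>e\<close> is then chosen small in terms of \<open>t\<close> and
      \<open>d\<close>.\<close>
    have "((\<lambda>e. t\<^sup>2 * 2 * (\<bar>t\<bar> * e + (t * e)\<^sup>2)) \<longlongrightarrow> t\<^sup>2 * 2 * (\<bar>t\<bar> * 0 + (t * 0)\<^sup>2)) (at_right 0)"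
      by (intro tendsto_intros)
    then have "eventually (\<lambda>e. t\<^sup>2 * 2 * (\<bar>t\<bar> * e + (t * e)\<^sup>2) < d) (at_right 0)"
      using d by (intro order_tendstoD(2)) auto
    moreover have "eventually (\<lambda>e::real. e > 0) (at_right 0)"
      by (simp add: eventually_at_right_less)
    ultimately have "eventually (\<lambda>e::real. e > 0 \<and> t\<^sup>2 * 2 * (\<bar>t\<bar> * e + (t * e)\<^sup>2) < d) (at_right 0)"
      by eventually_elim auto
    then obtain e :: real where e: "e > 0" "t\<^sup>2 * 2 * (\<bar>t\<bar> * e + (t * e)\<^sup>2) < d"
      using eventually_happens'[OF trivial_limit_at_right_real] by blast
    have "eventually (\<lambda>n. v n < 2) sequentially"
      using var by (intro order_tendstoD(2)[of _ 1]) (auto simp: v_def)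
    then show "eventually (\<lambda>n. dist (char (distr M borel (G n)) t - exp (- (t\<^sup>2 * v n / 2))) 0 < d) sequentially"
      using main[OF e(1)]
    proof eventually_elim
      case (elim n)
      have "t\<^sup>2 * v n * (\<bar>t\<bar> * e + (t * e)\<^sup>2) \<le> t\<^sup>2 * 2 * (\<bar>t\<bar> * e + (t * e)\<^sup>2)"
        using elim e by (intro mult_right_mono mult_left_mono) auto
      then show ?case using elim e by simp
    qed
  qed
  from tendsto_add[OF this lim_exp]
  have G_lim: "(\<lambda>n. char (distr M borel (G n)) t) \<longlonglongrightarrow> exp (- (t\<^sup>2 * 1 / 2))"
    by simp
  have "(\<lambda>n. char (distr M borel (F n)) t - char (distr M borel (G n)) t) \<longlonglongrightarrow> 0"
  proof (rule Lim_null_comparison)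
    show "eventually (\<lambda>n. norm (char (distr M borel (F n)) t - char (distr M borel (G n)) t) \<le> \<bar>t\<bar> * r n) sequentially"
      using close by eventually_elim (intro char_distr_diff_le, simp_all add: G_def sum_divide_distrib)
    show "(\<lambda>n. \<bar>t\<bar> * r n) \<longlonglongrightarrow> 0"
      using tendsto_mult[OF tendsto_const r, of "\<bar>t\<bar>"] by simp
  qed
  from tendsto_add[OF this G_lim]
  show "(\<lambda>n. char (distr M borel (F n)) t) \<longlonglongrightarrow> char std_normal_distribution t"
    by (simp add: char_std_normal_distribution)
qed

section \<open>Block lengths\<close>

locale cooling_regime =
  fixes \<tau> :: "nat \<Rightarrow> nat" and A :: real and \<nu> :: "nat pmf"
  assumes \<tau>: "cooling_rule \<tau>"
    and A: "A > 1"
    and \<tau>_asymp: "(\<lambda>k. real (\<tau> k)) \<sim>[at_top] (\<lambda>k. A * real k)"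
    and \<nu>_supp: "set_pmf \<nu> \<subseteq> {1..}"
    and freq_conv: "(\<lambda>n. increment_dist \<tau> \<nu> n) \<longlonglongrightarrow> 0"
begin

abbreviation N :: "nat \<Rightarrow> nat" where "N \<equiv> last_resampling \<tau>"

text \<open>Blocks are numbered from 0, whereas \<open>increment_freq\<close> counts them from
  1.\<close>

definition T :: "nat \<Rightarrow> nat" where "T k = \<tau> (Suc k) - \<tau> k"

text \<open>An infinite distance becomes 0, so estimates in terms of \<open>d n\<close> are made
  only where the distance is finite, which is eventually the case.\<close>

definition d :: "nat \<Rightarrow> real" where "d n = enn2real (increment_dist \<tau> \<nu> n)"

lemma N_ge: "\<tau> K \<le> n \<Longrightarrow> K \<le> N n"
  unfolding last_resampling_def using finite_resamplings[OF \<tau>] by (intro Max_ge) auto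

lemma filterlim_N: "filterlim N at_top sequentially"
  unfolding filterlim_at_top
proof
  fix K show "\<forall>\<^sub>F n in sequentially. K \<le> N n"
    using eventually_ge_at_top[of "\<tau> K"] by eventually_elim (rule N_ge)
qed

lemma N_le: "N n \<le> n"
  using cooling_rule_ge[OF \<tau>, of "N n"] last_resampling_le[OF \<tau>, of n] by simp

lemma sum_T: "(\<Sum>k<m. real (T k)) = real (\<tau> m)"
proof (induction m)
  case (Suc m)
  have "\<tau> m \<le> \<tau> (Suc m)" using cooling_rule_le_iff[OF \<tau>] by simp
  then show ?case using Suc by (simp add: T_def of_nat_diff)
qed (simp add: cooling_rule_0[OF \<tau>])

text \<open>Averaging over the first blocks is integration against the empirical law of their
  lengths. For \<open>N n = 0\<close> both sides vanish, as division by 0 gives 0.\<close>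

lemma increment_freq_sums:
  "(\<lambda>l. increment_freq \<tau> n l * g l) sums ((\<Sum>k<N n. g (T k)) / real (N n))"
proof -
  have "(\<lambda>l. of_bool (T k = l) * g l) sums g (T k)" for k
    using sums_single[of "T k" g] by (rule sums_cong[THEN iffD1, rotated]) auto
  then have "(\<lambda>l. (\<Sum>k<N n. of_bool (T k = l) * g l)) sums (\<Sum>k<N n. g (T k))"
    by (intro sums_sum)
  then have "(\<lambda>l. (\<Sum>k<N n. of_bool (T k = l) * g l) / real (N n)) sums ((\<Sum>k<N n. g (T k)) / real (N n))"
    by (rule sums_divide)
  moreover have "(\<Sum>k<N n. of_bool (T k = l) * g l) / real (N n) = increment_freq \<tau> n l * g l" for l
  proof -
    have "(\<Sum>k = 1..N n. of_bool (\<tau> k - \<tau> (k - 1) = l)) = (\<Sum>k<N n. of_bool (T k = l) :: real)"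
      by (rule sum.reindex_bij_witness[of _ Suc "\<lambda>k. k - 1"]) (auto simp: T_def)
    then show ?thesis by (simp add: increment_freq_def sum_distrib_right)
  qed
  ultimately show ?thesis by simp
qed

lemma eventually_increment_dist_finite: "eventually (\<lambda>n. increment_dist \<tau> \<nu> n < \<top>) sequentially"
  by (rule order_tendstoD(2)[OF freq_conv]) simp

lemma d_tendsto_0: "d \<longlonglongrightarrow> 0"
  unfolding d_def using freq_conv tendsto_enn2real[of "increment_dist \<tau> \<nu>" 0 sequentially] by simp

text \<open>The weighted distance is dual to functions of linear growth. The constant
  \<open>C\<close> enters only as a factor and may therefore depend on \<open>n\<close>, which the
  truncated variances exploit.\<close>

lemma
  assumes fin: "increment_dist \<tau> \<nu> n < \<top>" and g: "\<And>l. \<bar>g l\<bar> \<le> C * real l"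
  shows summable_pmf_mult: "summable (\<lambda>l. pmf \<nu> l * g l)"
    and block_average_error:
      "\<bar>(\<Sum>k<N n. g (T k)) / real (N n) - (\<Sum>l. pmf \<nu> l * g l)\<bar> \<le> C * d n"
proof -
  let ?\<delta> = "\<lambda>l. real l * \<bar>increment_freq \<tau> n l - pmf \<nu> l\<bar>"
  have dist: "increment_dist \<tau> \<nu> n = (\<Sum>l. ennreal (?\<delta> l))"
    by (simp add: increment_dist_def)
  have sum_\<delta>: "summable ?\<delta>"
    using fin unfolding dist by (intro summable_suminf_not_top) auto
  have "increment_dist \<tau> \<nu> n = ennreal (suminf ?\<delta>)"
    unfolding dist by (rule suminf_ennreal2) (use sum_\<delta> in auto)
  then have d: "d n = suminf ?\<delta>"
    using suminf_nonneg[OF sum_\<delta>] by (simp add: d_def)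
  let ?f = "\<lambda>l. (increment_freq \<tau> n l - pmf \<nu> l) * g l"
  have f_le: "norm (?f l) \<le> C * ?\<delta> l" for l
  proof -
    have "norm (?f l) = \<bar>increment_freq \<tau> n l - pmf \<nu> l\<bar> * \<bar>g l\<bar>"
      by (simp add: abs_mult)
    also have "\<dots> \<le> \<bar>increment_freq \<tau> n l - pmf \<nu> l\<bar> * (C * real l)"
      by (rule mult_left_mono[OF g]) simp
    finally show ?thesis by (simp add: mult_ac)
  qed
  have sum_C: "summable (\<lambda>l. C * ?\<delta> l)" by (rule summable_mult[OF sum_\<delta>])
  have sum_f: "summable ?f"
    by (rule summable_comparison_test'[OF sum_C f_le])
  note sum_L = increment_freq_sums[of n g]
  \<comment> \<open>The empirical side has finite support, so summability against
    \<open>\<nu>\<close> follows from that of the difference.\<close>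
  have "summable (\<lambda>l. increment_freq \<tau> n l * g l - ?f l)"
    by (rule summable_diff[OF sums_summable[OF sum_L] sum_f])
  then show "summable (\<lambda>l. pmf \<nu> l * g l)"
    by (simp add: algebra_simps)
  then have "(\<Sum>k<N n. g (T k)) / real (N n) - (\<Sum>l. pmf \<nu> l * g l) = suminf ?f"
    using sums_unique[OF sum_L] suminf_diff[OF sums_summable[OF sum_L]]
    by (simp add: left_diff_distrib)
  also have "\<bar>\<dots>\<bar> \<le> (\<Sum>l. C * ?\<delta> l)"
  proof -
    have "summable (\<lambda>l. \<bar>?f l\<bar>)"
      by (rule summable_comparison_test'[OF sum_C]) (use f_le in simp)
    then show ?thesis
      using summable_rabs[of ?f] suminf_le[of "\<lambda>l. \<bar>?f l\<bar>" "\<lambda>l. C * ?\<delta> l"] f_le sum_C by fastforce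
  qed
  also have "\<dots> = C * d n"
    unfolding d by (rule suminf_mult[OF sum_\<delta>])
  finally show "\<bar>(\<Sum>k<N n. g (T k)) / real (N n) - (\<Sum>l. pmf \<nu> l * g l)\<bar> \<le> C * d n" .
qed

lemma summable_pmf_linear:
  assumes "\<And>l. \<bar>g l\<bar> \<le> C * real l"
  shows "summable (\<lambda>l. pmf \<nu> l * g l)"
proof -
  obtain n where "increment_dist \<tau> \<nu> n < \<top>"
    using eventually_happens'[OF sequentially_bot eventually_increment_dist_finite] by blast
  then show ?thesis using assms by (rule summable_pmf_mult)
qed

lemma block_average_tendsto:
  assumes g: "\<And>l. \<bar>g l\<bar> \<le> C * real l"
  shows "(\<lambda>n. (\<Sum>k<N n. g (T k)) / real (N n)) \<longlonglongrightarrow> (\<Sum>l. pmf \<nu> l * g l)"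
proof (rule Lim_transform2[OF tendsto_const], rule Lim_null_comparison)
  show "\<forall>\<^sub>F n in sequentially. norm ((\<Sum>l. pmf \<nu> l * g l) - (\<Sum>k<N n. g (T k)) / real (N n)) \<le> C * d n"
    using eventually_increment_dist_finite
    by eventually_elim (subst norm_minus_commute, use block_average_error[OF _ g] in simp)
  show "(\<lambda>n. C * d n) \<longlonglongrightarrow> 0"
    using tendsto_mult[OF tendsto_const d_tendsto_0] by simp
qed

lemma \<tau>_ratio: "(\<lambda>k. real (\<tau> k) / real k) \<longlonglongrightarrow> A"
proof -
  have "(\<lambda>k. real (\<tau> k) / (A * real k)) \<longlonglongrightarrow> 1"
  proof (rule asymp_equivD_strong[OF \<tau>_asymp])
    show "eventually (\<lambda>k. real (\<tau> k) \<noteq> 0 \<or> A * real k \<noteq> 0) sequentially"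
      using eventually_gt_at_top[of 0] by eventually_elim (use A in simp)
  qed
  from tendsto_mult[OF tendsto_const this, of A] show ?thesis
    using A by simp
qed

text \<open>The block lengths telescope: their average is \<open>\<tau> (N n) / N n\<close>, whose
  limit is already known.\<close>

lemma pmf_mean: "(\<Sum>l. pmf \<nu> l * real l) = A"
proof (rule LIMSEQ_unique)
  show "(\<lambda>n. (\<Sum>k<N n. real (T k)) / real (N n)) \<longlonglongrightarrow> (\<Sum>l. pmf \<nu> l * real l)"
    by (rule block_average_tendsto[of real 1]) simp
  show "(\<lambda>n. (\<Sum>k<N n. real (T k)) / real (N n)) \<longlonglongrightarrow> A"
    unfolding sum_T by (rule filterlim_compose[OF \<tau>_ratio filterlim_N])
qed

text \<open>The asymptotics of \<open>\<tau>\<close> carry no rate; testing the distance with the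
  identity supplies one.\<close>

lemma \<tau>_N_error: "increment_dist \<tau> \<nu> n < \<top> \<Longrightarrow> \<bar>real (\<tau> (N n)) / real (N n) - A\<bar> \<le> d n"
  using block_average_error[of n real 1] by (simp add: sum_T pmf_mean)

lemma eventually_N_pos: "eventually (\<lambda>n. 0 < N n) sequentially"
  using filterlim_N[unfolded filterlim_at_top, rule_format, of 1] by eventually_elim simp

text \<open>The time \<open>n\<close> lies between two consecutive resamplings,
  \<open>\<tau> (N n)\<close> and \<open>\<tau> (Suc (N n))\<close>, which are asymptotically
  equivalent.\<close>

lemma N_ratio: "(\<lambda>n. real (N n) / real n) \<longlonglongrightarrow> 1 / A"
proof -
  have "(\<lambda>n. real n / real (N n)) \<longlonglongrightarrow> A"
  proof (rule real_tendsto_sandwich)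
    show "(\<lambda>n. real (\<tau> (N n)) / real (N n)) \<longlonglongrightarrow> A"
      by (rule filterlim_compose[OF \<tau>_ratio filterlim_N])
    have "(\<lambda>k. real (\<tau> (Suc k)) / real (Suc k) * (1 + 1 / real k)) \<longlonglongrightarrow> A * (1 + 0)"
      by (intro tendsto_intros LIMSEQ_Suc[OF \<tau>_ratio] lim_1_over_n)
    moreover have "eventually (\<lambda>k. real (\<tau> (Suc k)) / real (Suc k) * (1 + 1 / real k) = real (\<tau> (Suc k)) / real k) sequentially"
      using eventually_gt_at_top[of 0]
    proof eventually_elim
      case (elim k)
      then have "1 + 1 / real k = real (Suc k) / real k" by (simp add: field_simps)
      then show ?case by simp
    qed
    ultimately have "(\<lambda>k. real (\<tau> (Suc k)) / real k) \<longlonglongrightarrow> A"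
      by (simp add: tendsto_cong)
    then show "(\<lambda>n. real (\<tau> (Suc (N n))) / real (N n)) \<longlonglongrightarrow> A"
      by (rule filterlim_compose[OF _ filterlim_N])
    show "\<forall>\<^sub>F n in sequentially. real (\<tau> (N n)) / real (N n) \<le> real n / real (N n)"
      using last_resampling_le[OF \<tau>] by (intro always_eventually allI divide_right_mono) auto
    show "\<forall>\<^sub>F n in sequentially. real n / real (N n) \<le> real (\<tau> (Suc (N n))) / real (N n)"
      using last_resampling_less[OF \<tau>] by (intro always_eventually allI divide_right_mono) (auto intro: less_imp_le)
  qed
  from tendsto_inverse[OF this] show ?thesis
    using A by (simp add: divide_inverse mult.commute)
qed

lemma last_block_negligible: "(\<lambda>n. real (n - \<tau> (N n)) / real n) \<longlonglongrightarrow> 0"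
proof -
  have "(\<lambda>n. 1 - real (\<tau> (N n)) / real (N n) * (real (N n) / real n)) \<longlonglongrightarrow> 1 - A * (1 / A)"
    by (intro tendsto_intros N_ratio filterlim_compose[OF \<tau>_ratio filterlim_N])
  moreover have "eventually (\<lambda>n. 1 - real (\<tau> (N n)) / real (N n) * (real (N n) / real n)
      = real (n - \<tau> (N n)) / real n) sequentially"
    using eventually_N_pos eventually_gt_at_top[of 0]
    by eventually_elim (use last_resampling_le[OF \<tau>] in \<open>simp add: of_nat_diff diff_divide_distrib\<close>)
  ultimately show ?thesis using A by (simp add: tendsto_cong)
qed

text \<open>
  Since \<open>\<nu>\<close> has mean \<open>A\<close>, the blocks longer than \<open>K\<close> cover a fraction of time that vanishes
  as \<open>K\<close> grows, so bounded blocks suffice.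
\<close>

lemma strong_law_from_short_blocks:
  fixes x y g :: "nat \<Rightarrow> real"
  assumes g: "\<And>l. \<bar>g l\<bar> \<le> real l" and y: "\<And>k. \<bar>y k\<bar> \<le> real (T k)"
    and x: "\<And>n. \<bar>x n - (\<Sum>k<N n. y k)\<bar> \<le> real (n - \<tau> (N n))"
    and short: "\<And>K. (\<lambda>n. (\<Sum>k<n. if T k \<le> K then y k - g (T k) else 0) / real n) \<longlonglongrightarrow> 0"
  shows "(\<lambda>n. x n / real n) \<longlonglongrightarrow> 1 / A * (\<Sum>l. pmf \<nu> l * g l)"
proof -
  define h where "h K l = (if K < l then real l else 0)" for K l :: nat
  have h: "\<bar>h K l\<bar> \<le> 1 * real l" for K l by (simp add: h_def)
  have tail: "(\<lambda>K. \<Sum>l. pmf \<nu> l * h K l) \<longlonglongrightarrow> 0"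
  proof -
    have sm: "summable (\<lambda>l. pmf \<nu> l * real l)"
      by (rule summable_pmf_linear[of real 1]) simp
    have "(\<Sum>l. pmf \<nu> l * h K l) = (\<Sum>l. pmf \<nu> l * real l) - (\<Sum>l<Suc K. pmf \<nu> l * real l)" for K
    proof -
      have "(\<Sum>l. pmf \<nu> l * h K l) = (\<Sum>l. pmf \<nu> (l + Suc K) * h K (l + Suc K)) + (\<Sum>l<Suc K. pmf \<nu> l * h K l)"
        by (rule suminf_split_initial_segment[OF summable_pmf_linear[OF h]])
      also have "(\<Sum>l<Suc K. pmf \<nu> l * h K l) = 0"
        by (rule sum.neutral) (auto simp: h_def)
      also have "(\<lambda>l. pmf \<nu> (l + Suc K) * h K (l + Suc K)) = (\<lambda>l. pmf \<nu> (l + Suc K) * real (l + Suc K))"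
        by (auto simp: h_def)
      also have "(\<Sum>l. pmf \<nu> (l + Suc K) * real (l + Suc K))
          = (\<Sum>l. pmf \<nu> l * real l) - (\<Sum>l<Suc K. pmf \<nu> l * real l)"
        by (rule suminf_minus_initial_segment[OF sm])
      finally show ?thesis by simp
    qed
    moreover have "(\<lambda>K. (\<Sum>l. pmf \<nu> l * real l) - (\<Sum>l<Suc K. pmf \<nu> l * real l))
       \<longlonglongrightarrow> (\<Sum>l. pmf \<nu> l * real l) - (\<Sum>l. pmf \<nu> l * real l)"
      by (intro tendsto_intros LIMSEQ_Suc[OF summable_LIMSEQ[OF sm]])
    ultimately show ?thesis by simp
  qed
  have "(\<lambda>n. (\<Sum>k<N n. y k - g (T k)) / real (N n)) \<longlonglongrightarrow> 0"
  proof (rule tendstoI)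
    fix e :: real assume e: "e > 0"
    \<comment> \<open>A long block costs at most twice its length, once for \<open>y\<close> and
      once for \<open>g\<close>; so \<open>2 * (e / 4)\<close> for the long blocks and
      \<open>e / 2\<close> for the short ones add up to \<open>e\<close>.\<close>
    have "eventually (\<lambda>K. (\<Sum>l. pmf \<nu> l * h K l) < e / 4) sequentially"
      using tail e by (intro order_tendstoD(2)) auto
    then obtain K where K: "(\<Sum>l. pmf \<nu> l * h K l) < e / 4"
      using eventually_happens'[OF sequentially_bot] by blast
    have "eventually (\<lambda>n. (\<Sum>k<N n. h K (T k)) / real (N n) < e / 4) sequentially"
      using block_average_tendsto[OF h] K by (rule order_tendstoD(2))
    moreover have "eventually (\<lambda>n. dist ((\<Sum>k<N n. if T k \<le> K then y k - g (T k) else 0) / real (N n)) 0 < e / 2) sequentially"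
      by (rule tendstoD[OF filterlim_compose[OF short filterlim_N]]) (use e in simp)
    ultimately show "eventually (\<lambda>n. dist ((\<Sum>k<N n. y k - g (T k)) / real (N n)) 0 < e) sequentially"
    proof eventually_elim
      case (elim n)
      have "\<bar>(\<Sum>k<N n. y k - g (T k)) - (\<Sum>k<N n. if T k \<le> K then y k - g (T k) else 0)\<bar>
          = \<bar>\<Sum>k<N n. if T k \<le> K then 0 else y k - g (T k)\<bar>"
        by (subst sum_subtractf[symmetric]) (auto intro!: arg_cong[where f=abs] sum.cong)
      also have "\<dots> \<le> (\<Sum>k<N n. \<bar>if T k \<le> K then 0 else y k - g (T k)\<bar>)"
        by (rule sum_abs)
      also have "\<dots> \<le> (\<Sum>k<N n. 2 * h K (T k))"
      proof (rule sum_mono)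
        fix k show "\<bar>if T k \<le> K then 0 else y k - g (T k)\<bar> \<le> 2 * h K (T k)"
          using y[of k] g[of "T k"] by (auto simp: h_def)
      qed
      also have "\<dots> = 2 * (\<Sum>k<N n. h K (T k))" by (rule sum_distrib_left[symmetric])
      finally have "\<bar>(\<Sum>k<N n. y k - g (T k)) - (\<Sum>k<N n. if T k \<le> K then y k - g (T k) else 0)\<bar> / real (N n)
          \<le> 2 * (\<Sum>k<N n. h K (T k)) / real (N n)"
        by (rule divide_right_mono) simp
      then have "\<bar>(\<Sum>k<N n. y k - g (T k)) / real (N n) - (\<Sum>k<N n. if T k \<le> K then y k - g (T k) else 0) / real (N n)\<bar>
          \<le> 2 * ((\<Sum>k<N n. h K (T k)) / real (N n))"
        by (simp flip: diff_divide_distrib)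
      moreover have "dist p 0 < e" if "\<bar>p - q\<bar> \<le> 2 * r" "r < e / 4" "dist q 0 < e / 2" for p q r
        using that by (simp add: dist_real_def)
      ultimately show ?case using elim by blast
    qed
  qed
  from tendsto_add[OF this block_average_tendsto[of g 1]]
  have avg: "(\<lambda>n. (\<Sum>k<N n. y k) / real (N n)) \<longlonglongrightarrow> (\<Sum>l. pmf \<nu> l * g l)"
    using g by (simp add: sum_subtractf diff_divide_distrib)
  have "(\<lambda>n. (real (N n) / real n) * ((\<Sum>k<N n. y k) / real (N n)) + (x n - (\<Sum>k<N n. y k)) / real n)
      \<longlonglongrightarrow> 1 / A * (\<Sum>l. pmf \<nu> l * g l) + 0"
  proof (intro tendsto_add tendsto_mult N_ratio avg)
    show "(\<lambda>n. (x n - (\<Sum>k<N n. y k)) / real n) \<longlonglongrightarrow> 0"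
      by (rule Lim_null_comparison[OF _ last_block_negligible])
         (use x in \<open>auto intro!: always_eventually divide_right_mono\<close>)
  qed
  moreover have "eventually (\<lambda>n. (real (N n) / real n) * ((\<Sum>k<N n. y k) / real (N n)) + (x n - (\<Sum>k<N n. y k)) / real n
      = x n / real n) sequentially"
    using eventually_N_pos by eventually_elim (simp add: diff_divide_distrib)
  ultimately show ?thesis by (simp add: tendsto_cong)
qed

text \<open>At time \<open>\<tau> (Suc k) - 1\<close> the unfinished block is block \<open>k\<close>
  without its last step, and \<open>\<tau> (Suc k)\<close> is at most \<open>n\<close> for all
  blocks considered. Only blocks ending at or before \<open>n0\<close> escape this argument; their
  length is at most \<open>n0\<close>.\<close>

lemma blocks_small:
  assumes last: "(\<lambda>n. real (n - \<tau> (N n)) / sqrt (real n)) \<longlonglongrightarrow> 0" and e: "e > 0"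
  shows "eventually (\<lambda>n. \<forall>k<N n. real (T k) \<le> e * sqrt (real n)) sequentially"
proof -
  have "eventually (\<lambda>n. real (n - \<tau> (N n)) / sqrt (real n) < e / 2) sequentially"
    using last e by (intro order_tendstoD(2)) auto
  then obtain n0 where n0: "\<And>n. n0 \<le> n \<Longrightarrow> real (n - \<tau> (N n)) / sqrt (real n) < e / 2"
    by (auto simp: eventually_sequentially)
  have last_le: "real (n - \<tau> (N n)) \<le> e / 2 * sqrt (real n)" if "n0 \<le> n" for n
  proof (cases "n = 0")
    case False
    then show ?thesis using n0[OF that] by (simp add: pos_divide_less_eq)
  qed simp
  have "filterlim (\<lambda>n. sqrt (real n)) at_top sequentially"
    by (rule filterlim_compose[OF sqrt_at_top filterlim_real_sequentially])
  \<comment> \<open>The threshold makes \<open>n0 + 1\<close> at most half of the target, which pays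
    both for the early blocks and for the missing last step of the others.\<close>
  then have "eventually (\<lambda>n. 2 / e * (real n0 + 1) \<le> sqrt (real n)) sequentially"
    by (simp add: filterlim_at_top)
  then show ?thesis
  proof (eventually_elim, safe)
    fix n k assume "2 / e * (real n0 + 1) \<le> sqrt (real n)" and k: "k < N n"
    then have n: "real n0 + 1 \<le> e / 2 * sqrt (real n)"
      using e by (simp add: field_simps)
    have "\<tau> (Suc k) \<le> \<tau> (N n)" using k cooling_rule_le_iff[OF \<tau>] by simp
    then have kn: "\<tau> (Suc k) \<le> n" using last_resampling_le[OF \<tau>, of n] by linarith
    have kk: "\<tau> k < \<tau> (Suc k)" using cooling_rule_less_iff[OF \<tau>] by simp
    show "real (T k) \<le> e * sqrt (real n)"
    proof (cases "n0 \<le> \<tau> (Suc k) - 1")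
      case True
      have "N (\<tau> (Suc k) - 1) = k"
        using kk by (intro last_resampling_eq[OF \<tau>]) auto
      then have "real (\<tau> (Suc k) - 1 - \<tau> k) \<le> e / 2 * sqrt (real (\<tau> (Suc k) - 1))"
        using last_le[OF True] by simp
      also have "\<dots> \<le> e / 2 * sqrt (real n)"
        using e kn by (intro mult_left_mono real_sqrt_le_mono) auto
      finally have "real (\<tau> (Suc k) - 1 - \<tau> k) \<le> e / 2 * sqrt (real n)" .
      moreover have "real (T k) = real (\<tau> (Suc k) - 1 - \<tau> k) + 1"
        using kk by (simp add: T_def of_nat_diff)
      ultimately show ?thesis using n by simp
    next
      case False
      then have "real (T k) \<le> real n0" by (simp add: T_def)
      also have "\<dots> \<le> e * sqrt (real n)"
        using n e by (smt (verit) field_sum_of_halves mult_nonneg_nonneg of_nat_0_le_iff real_sqrt_ge_zero distrib_right)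
      finally show ?thesis .
    qed
  qed
qed

lemma variance_average_tendsto:
  fixes V :: "nat \<Rightarrow> real"
  assumes V: "\<And>l. 0 \<le> V l" "\<And>l. V l \<le> (real l)\<^sup>2" and summable: "summable (\<lambda>l. pmf \<nu> l * V l)"
    and last: "(\<lambda>n. real (n - \<tau> (N n)) / sqrt (real n)) \<longlonglongrightarrow> 0"
    and fast: "(\<lambda>n. d n * sqrt (real n)) \<longlonglongrightarrow> 0"
  shows "(\<lambda>n. (\<Sum>k<N n. V (T k)) / real (N n)) \<longlonglongrightarrow> (\<Sum>l. pmf \<nu> l * V l)"
proof -
  define m where "m n = nat \<lfloor>sqrt (real n)\<rfloor>" for n :: nat
  have m_le: "real (m n) \<le> sqrt (real n)" for n
    unfolding m_def by (simp add: of_nat_floor)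
  have m_lim: "filterlim m at_top sequentially"
  proof -
    have "filterlim (\<lambda>n. nat \<lfloor>sqrt (real n)\<rfloor>) at_top sequentially"
      by (intro filterlim_compose[OF filterlim_nat_sequentially] filterlim_compose[OF filterlim_floor_sequentially]
          filterlim_compose[OF sqrt_at_top filterlim_real_sequentially])
    then show ?thesis by (simp add: m_def[abs_def])
  qed
  define V' where "V' m l = (if l \<le> m then V l else 0)" for m l :: nat
  \<comment> \<open>The cutoff trades the quadratic bound for a linear one with constant
    \<open>m\<close>, which is what \<open>block_average_error\<close> accepts.\<close>
  have V': "\<bar>V' m l\<bar> \<le> real m * real l" for m l
  proof (cases "l \<le> m")
    case True
    have "V l \<le> real l * real l" using V(2)[of l] by (simp add: power2_eq_square)
    also have "\<dots> \<le> real m * real l" using True by (intro mult_right_mono) auto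
    finally show ?thesis using V(1) True by (simp add: V'_def)
  qed (simp add: V'_def)
  have V'_sum: "(\<Sum>l. pmf \<nu> l * V' m l) = (\<Sum>l<Suc m. pmf \<nu> l * V l)" for m
    by (subst suminf_finite[of "{..<Suc m}"]) (auto simp: V'_def intro!: sum.cong)
  have error: "(\<lambda>n. (\<Sum>k<N n. V' (m n) (T k)) / real (N n) - (\<Sum>l<Suc (m n). pmf \<nu> l * V l)) \<longlonglongrightarrow> 0"
  proof (rule Lim_null_comparison[OF _ fast])
    show "\<forall>\<^sub>F n in sequentially. norm ((\<Sum>k<N n. V' (m n) (T k)) / real (N n) - (\<Sum>l<Suc (m n). pmf \<nu> l * V l)) \<le> d n * sqrt (real n)"
      using eventually_increment_dist_finite
    proof eventually_elim
      case (elim n)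
      have "\<bar>(\<Sum>k<N n. V' (m n) (T k)) / real (N n) - (\<Sum>l<Suc (m n). pmf \<nu> l * V l)\<bar> \<le> real (m n) * d n"
        using block_average_error[OF elim V', of "m n"] by (simp add: V'_sum)
      also have "\<dots> \<le> sqrt (real n) * d n"
        using m_le by (intro mult_right_mono) (auto simp: d_def)
      finally show ?case by (simp add: mult.commute)
    qed
  qed
  have "(\<lambda>n. \<Sum>l<Suc (m n). pmf \<nu> l * V l) \<longlonglongrightarrow> (\<Sum>l. pmf \<nu> l * V l)"
    by (rule filterlim_compose[OF LIMSEQ_Suc[OF summable_LIMSEQ[OF summable]] m_lim])
  from tendsto_add[OF error this]
  have "(\<lambda>n. (\<Sum>k<N n. V' (m n) (T k)) / real (N n)) \<longlonglongrightarrow> (\<Sum>l. pmf \<nu> l * V l)"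
    by (simp only: diff_add_cancel add_0)
  \<comment> \<open>With \<open>e = 1\<close> in \<open>blocks_small\<close>, no block up to time
    \<open>n\<close> exceeds the cutoff, so the truncation eventually changes nothing.\<close>
  moreover have "eventually (\<lambda>n. (\<Sum>k<N n. V' (m n) (T k)) / real (N n) = (\<Sum>k<N n. V (T k)) / real (N n)) sequentially"
    using blocks_small[OF last zero_less_one]
  proof eventually_elim
    case (elim n)
    then have "T k \<le> m n" if "k < N n" for k
      using that by (simp add: m_def le_nat_floor)
    then show ?case by (simp add: V'_def)
  qed
  ultimately show ?thesis by (simp add: tendsto_cong)
qed

text \<open>The difference splits into the error of the block average of \<open>g\<close>, the error
  of \<open>\<tau> (N n)\<close> against \<open>A * N n\<close>, and the drift of the unfinished
  block. The first two are of order \<open>N n * d n\<close>, hence at most of order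
  \<open>n * d n\<close>, which is small against the square root of \<open>n\<close>.\<close>

lemma centering_negligible:
  fixes g :: "nat \<Rightarrow> real"
  assumes g: "\<And>l. \<bar>g l\<bar> \<le> real l"
    and last: "(\<lambda>n. real (n - \<tau> (N n)) / sqrt (real n)) \<longlonglongrightarrow> 0"
    and fast: "(\<lambda>n. d n * sqrt (real n)) \<longlonglongrightarrow> 0"
  defines "v \<equiv> 1 / A * (\<Sum>l. pmf \<nu> l * g l)"
  shows "(\<lambda>n. ((\<Sum>k<N n. g (T k)) - v * real n) / sqrt (real n)) \<longlonglongrightarrow> 0"
proof (rule Lim_null_comparison)
  let ?r = "\<lambda>n. (1 + \<bar>v\<bar>) * (d n * sqrt (real n)) + \<bar>v\<bar> * (real (n - \<tau> (N n)) / sqrt (real n))"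
  show "?r \<longlonglongrightarrow> 0"
    using tendsto_add[OF tendsto_mult[OF tendsto_const fast] tendsto_mult[OF tendsto_const last]] by simp
  show "\<forall>\<^sub>F n in sequentially. norm (((\<Sum>k<N n. g (T k)) - v * real n) / sqrt (real n)) \<le> ?r n"
    using eventually_increment_dist_finite eventually_N_pos eventually_gt_at_top[of 0]
  proof eventually_elim
    case (elim n)
    let ?S = "\<Sum>k<N n. g (T k)"
    have d: "0 \<le> d n" by (simp add: d_def)
    have scale: "\<bar>a - real (N n) * b\<bar> \<le> real (N n) * d n" if "\<bar>a / real (N n) - b\<bar> \<le> d n" for a b
    proof -
      have "a - real (N n) * b = real (N n) * (a / real (N n) - b)"
        using elim(2) by (simp add: right_diff_distrib)
      then have "\<bar>a - real (N n) * b\<bar> = real (N n) * \<bar>a / real (N n) - b\<bar>"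
        by (simp only: abs_mult abs_of_nat)
      then show ?thesis using that by (simp only: mult_left_mono of_nat_0_le_iff)
    qed
    have vA: "(\<Sum>l. pmf \<nu> l * g l) = A * v" using A by (simp add: v_def)
    have 1: "\<bar>?S - real (N n) * (A * v)\<bar> \<le> real (N n) * d n"
      by (rule scale) (use block_average_error[of n g 1] elim(1) g vA in simp)
    have 2: "\<bar>real (\<tau> (N n)) - real (N n) * A\<bar> \<le> real (N n) * d n"
      by (rule scale[OF \<tau>_N_error[OF elim(1)]])
    have "?S - v * real n = (?S - real (N n) * (A * v)) - v * (real (\<tau> (N n)) - real (N n) * A)
        - v * real (n - \<tau> (N n))"
      using last_resampling_le[OF \<tau>, of n] by (simp add: of_nat_diff algebra_simps)
    moreover have "\<bar>p - q - r\<bar> \<le> \<bar>p\<bar> + \<bar>q\<bar> + \<bar>r\<bar>" for p q r :: real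
      by linarith
    ultimately have "\<bar>?S - v * real n\<bar> \<le> \<bar>?S - real (N n) * (A * v)\<bar> + \<bar>v * (real (\<tau> (N n)) - real (N n) * A)\<bar>
        + \<bar>v * real (n - \<tau> (N n))\<bar>"
      by presburger
    then have "\<bar>?S - v * real n\<bar> \<le> \<bar>?S - real (N n) * (A * v)\<bar> + \<bar>v\<bar> * \<bar>real (\<tau> (N n)) - real (N n) * A\<bar>
        + \<bar>v\<bar> * real (n - \<tau> (N n))"
      by (simp only: abs_mult abs_of_nat)
    also have "\<dots> \<le> real (N n) * d n + \<bar>v\<bar> * (real (N n) * d n) + \<bar>v\<bar> * real (n - \<tau> (N n))"
      using 1 2 by (intro add_mono mult_left_mono) auto
    also have "\<dots> = (1 + \<bar>v\<bar>) * (real (N n) * d n) + \<bar>v\<bar> * real (n - \<tau> (N n))"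
      by (simp add: algebra_simps)
    also have "\<dots> \<le> (1 + \<bar>v\<bar>) * (real n * d n) + \<bar>v\<bar> * real (n - \<tau> (N n))"
      using d N_le by (intro add_mono mult_left_mono mult_right_mono) auto
    finally have "\<bar>?S - v * real n\<bar> / sqrt (real n) \<le> ((1 + \<bar>v\<bar>) * (real n * d n) + \<bar>v\<bar> * real (n - \<tau> (N n))) / sqrt (real n)"
      by (rule divide_right_mono) simp
    also have "\<dots> = (1 + \<bar>v\<bar>) * (d n * (real n / sqrt (real n))) + \<bar>v\<bar> * (real (n - \<tau> (N n)) / sqrt (real n))"
      by (simp add: add_divide_distrib mult_ac)
    also have "real n / sqrt (real n) = sqrt (real n)"
      by (simp add: real_div_sqrt)
    finally show ?case by simp
  qed
qed

end

section \<open>The two limit theorems\<close>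

context rwre begin

lemma position_measurable [measurable]: "(\<lambda>z. real_of_int (z l)) \<in> borel_measurable (rwre_law \<alpha>)"
  by measurable

lemma AE_position_bound: "AE z in rwre_law \<alpha>. \<bar>real_of_int (z l)\<bar> \<le> real l"
  using AE_rwre_bound by eventually_elim (metis of_int_abs of_int_le_iff of_int_of_nat_eq)

lemma integrable_position: "integrable (rwre_law \<alpha>) (\<lambda>z. real_of_int (z l))"
  using AE_position_bound by (intro Z.integrable_const_bound[where B="real l"]) auto

lemma abs_rwre_mean_le: "\<bar>rwre_mean \<alpha> l\<bar> \<le> real l"
proof -
  have "\<bar>rwre_mean \<alpha> l\<bar> \<le> (\<integral>z. \<bar>real_of_int (z l)\<bar> \<partial>rwre_law \<alpha>)"
    unfolding rwre_mean_def by (rule integral_abs_bound)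
  also have "\<dots> \<le> (\<integral>z. real l \<partial>rwre_law \<alpha>)"
    using integrable_position AE_position_bound by (intro integral_mono_AE) auto
  finally show ?thesis using Z.prob_space by simp
qed

lemma AE_position_sq: "AE z in rwre_law \<alpha>. (real_of_int (z l))\<^sup>2 \<le> (real l)\<^sup>2"
  using AE_position_bound[of l] by eventually_elim (metis abs_ge_zero power2_abs power_mono)

lemma integrable_position_sq: "integrable (rwre_law \<alpha>) (\<lambda>z. (real_of_int (z l))\<^sup>2)"
  using AE_position_sq by (intro Z.integrable_const_bound[where B="(real l)\<^sup>2"]) auto

lemma rwre_var_nonneg: "0 \<le> rwre_var \<alpha> l"
  by (simp add: rwre_var_def)

lemma rwre_var_le: "rwre_var \<alpha> l \<le> (real l)\<^sup>2"
proof -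
  have "rwre_var \<alpha> l = (\<integral>z. (real_of_int (z l))\<^sup>2 \<partial>rwre_law \<alpha>) - (rwre_mean \<alpha> l)\<^sup>2"
    unfolding rwre_var_def rwre_mean_def
    by (rule Z.variance_eq[OF integrable_position integrable_position_sq])
  also have "\<dots> \<le> (\<integral>z. (real_of_int (z l))\<^sup>2 \<partial>rwre_law \<alpha>)" by simp
  also have "\<dots> \<le> (\<integral>z. (real l)\<^sup>2 \<partial>rwre_law \<alpha>)"
    using integrable_position_sq AE_position_sq by (intro integral_mono_AE) auto
  finally show ?thesis using Z.prob_space by simp
qed

lemma AE_env_unit: "AE \<omega> in env_law \<alpha>. \<forall>x. 0 < \<omega> x \<and> \<omega> x < 1"
  unfolding AE_all_countable env_law_def
  using \<alpha>_unit by (intro allI AE_PiM_component) (auto simp: \<alpha>.prob_space_axioms)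

text \<open>Since \<open>\<alpha>\<close> charges only the open interval, in almost every
  environment each step in either direction has positive probability.\<close>

lemma straight_path_pos:
  assumes "\<bar>c\<bar> = 1"
  shows "emeasure (rwre_law \<alpha>) (path_cylinder n (\<lambda>i. c * int i)) \<noteq> 0"
proof
  assume "emeasure (rwre_law \<alpha>) (path_cylinder n (\<lambda>i. c * int i)) = 0"
  then have "AE \<omega> in env_law \<alpha>. ennreal (path_weight n (\<lambda>i. c * int i) (\<lambda>_. \<omega>)) = 0"
    using measurable_compose[OF path_weight_const_measurable measurable_ennreal]
    by (simp add: emeasure_rwre_law_cylinder nn_integral_0_iff_AE)
  with AE_env_unit have "AE \<omega> in env_law \<alpha>. False"
  proof eventually_elim
    case (elim \<omega>)
    have "0 < path_weight n (\<lambda>i. c * int i) (\<lambda>_. \<omega>)"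
      unfolding path_weight_def
    proof (rule prod_pos)
      fix i
      have "c * int (Suc i) - c * int i = c" by (simp add: algebra_simps)
      then show "0 < step_prob (\<omega> (c * int i)) (c * int (Suc i) - c * int i)"
        using elim(1) assms by (auto simp: step_prob_eq abs_if split: if_splits)
    qed
    with elim(2) show False by simp
  qed
  then show False by simp
qed

text \<open>A vanishing variance would force the position at time \<open>l\<close> to be constant,
  although \<open>l\<close> and \<open>- l\<close> are both reached with positive
  probability.\<close>

lemma rwre_var_pos:
  assumes "0 < l"
  shows "0 < rwre_var \<alpha> l"
proof (rule ccontr)
  assume "\<not> 0 < rwre_var \<alpha> l"
  then have var0: "rwre_var \<alpha> l = 0" using rwre_var_nonneg[of l] by simp
  have "integrable (rwre_law \<alpha>) (\<lambda>z. (real_of_int (z l) - rwre_mean \<alpha> l)\<^sup>2)"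
    using integrable_position integrable_position_sq by (simp add: power2_diff)
  then have const: "AE z in rwre_law \<alpha>. real_of_int (z l) = rwre_mean \<alpha> l"
    using var0 integral_nonneg_eq_0_iff_AE[of "rwre_law \<alpha>" "\<lambda>z. (real_of_int (z l) - rwre_mean \<alpha> l)\<^sup>2"]
    by (simp add: rwre_var_def)
  have "real_of_int (c * int l) = rwre_mean \<alpha> l" if "\<bar>c\<bar> = 1" for c
  proof (rule ccontr)
    assume ne: "real_of_int (c * int l) \<noteq> rwre_mean \<alpha> l"
    have "AE z in rwre_law \<alpha>. z \<notin> path_cylinder l (\<lambda>i. c * int i)"
      using const
    proof eventually_elim
      case (elim z)
      show ?case
      proof
        assume "z \<in> path_cylinder l (\<lambda>i. c * int i)"
        then have "z l = c * int l" by (simp add: path_cylinder_def)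
        with elim ne show False by metis
      qed
    qed
    then have "emeasure (rwre_law \<alpha>) {z \<in> space (rwre_law \<alpha>). z \<in> path_cylinder l (\<lambda>i. c * int i)} = 0"
      by (rule emeasure_eq_0_AE)
    with straight_path_pos[OF that, of l] show False by simp
  qed
  from this[of 1] this[of "-1"] show False using assms by simp
qed

end

section \<open>The cooled walk realised on the space of independent walks\<close>

locale rwcre = rwre \<alpha> + cooling_regime \<tau> A \<nu> for \<alpha> \<tau> A \<nu>
begin

definition increment :: "nat \<Rightarrow> (nat \<Rightarrow> nat \<Rightarrow> int) \<Rightarrow> real" where
  "increment k w = real_of_int (w k (T k))"

lemma concat_measurable [measurable]: "concat_walks \<tau> \<in> walks_law \<rightarrow>\<^sub>M path_space"
  by (rule concat_walks_measurable) simp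

lemma increment_measurable [measurable]: "increment k \<in> borel_measurable walks_law"
  unfolding increment_def
  by (rule measurable_compose[where f="\<lambda>w. w k" and g="\<lambda>z. real_of_int (z (T k))"])
     (auto intro: position_measurable)

lemma indep_increments: "W.indep_vars (\<lambda>_. borel) increment UNIV"
  unfolding increment_def[abs_def]
  by (rule W.indep_vars_compose2[OF indep_vars_PiM_coordinates[OF Z.prob_space_axioms]])
     (rule position_measurable)

lemma integral_increment:
  fixes f :: "real \<Rightarrow> real"
  assumes [measurable]: "f \<in> borel_measurable borel"
  shows "W.expectation (\<lambda>w. f (increment k w)) = (\<integral>z. f (real_of_int (z (T k))) \<partial>rwre_law \<alpha>)"
proof -
  have "(\<integral>z. f (real_of_int (z (T k))) \<partial>rwre_law \<alpha>)
     = (\<integral>z. f (real_of_int (z (T k))) \<partial>distr walks_law (rwre_law \<alpha>) (\<lambda>w. w k))"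
    by (subst distr_PiM_component) (auto simp: Z.prob_space_axioms)
  also have "\<dots> = W.expectation (\<lambda>w. f (real_of_int (w k (T k))))"
  proof (rule integral_distr[where g="\<lambda>w. w k" and f="\<lambda>z. f (real_of_int (z (T k)))"])
    show "(\<lambda>z. f (real_of_int (z (T k)))) \<in> borel_measurable (rwre_law \<alpha>)"
      by (rule measurable_compose[OF position_measurable]) measurable
  qed simp
  finally show ?thesis by (simp add: increment_def)
qed

lemma expectation_increment: "W.expectation (increment k) = rwre_mean \<alpha> (T k)"
  using integral_increment[of "\<lambda>x. x" k] by (simp add: rwre_mean_def)

lemma variance_increment: "W.variance (increment k) = rwre_var \<alpha> (T k)"
  unfolding expectation_increment
  using integral_increment[of "\<lambda>x. (x - rwre_mean \<alpha> (T k))\<^sup>2" k] by (simp add: rwre_var_def)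

lemma AE_increment_bound: "AE w in walks_law. \<bar>increment k w\<bar> \<le> real (T k)"
  using AE_walks_bound unfolding increment_def
  by eventually_elim (metis of_int_abs of_int_le_iff of_int_of_nat_eq)

text \<open>The discrepancy is precisely the current walk at its running time, and no walk is faster
  than one unit per step.\<close>

lemma AE_concat_close:
  "AE w in walks_law. \<forall>n. \<bar>real_of_int (concat_walks \<tau> w n) - (\<Sum>k<N n. increment k w)\<bar> \<le> real (n - \<tau> (N n))"
  using AE_walks_bound
proof eventually_elim
  case (elim w)
  show ?case
  proof
    fix n
    have "real_of_int (concat_walks \<tau> w n) - (\<Sum>k<N n. increment k w) = real_of_int (w (N n) (n - \<tau> (N n)))"
      by (simp add: concat_walks_def increment_def T_def)
    then show "\<bar>real_of_int (concat_walks \<tau> w n) - (\<Sum>k<N n. increment k w)\<bar> \<le> real (n - \<tau> (N n))"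
      using elim[rule_format, of "N n" "n - \<tau> (N n)"]
      by (metis of_int_abs of_int_le_iff of_int_of_nat_eq)
  qed
qed

lemma strong_law_walks:
  "AE w in walks_law. (\<lambda>n. real_of_int (concat_walks \<tau> w n) / real n) \<longlonglongrightarrow> v_nu \<alpha> A \<nu>"
proof -
  have "AE w in walks_law. (\<lambda>n. (\<Sum>k<n. if T k \<le> K then increment k w - rwre_mean \<alpha> (T k) else 0) / real n) \<longlonglongrightarrow> 0"
    for K
  proof -
    \<comment> \<open>Increments over long blocks are set to 0 rather than dropped: the numbering of
      blocks is kept and all variables are bounded by \<open>K\<close>.\<close>
    define X where "X k w = (if T k \<le> K then increment k w else 0)" for k w
    have "W.indep_vars (\<lambda>_. borel) X UNIV"
      unfolding X_def[abs_def]
      by (rule W.indep_vars_compose2[OF indep_increments, where Y="\<lambda>k x. if T k \<le> K then x else 0"]) simp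
    moreover have "AE w in walks_law. \<bar>X k w\<bar> \<le> real K" for k
      using AE_increment_bound[of k] by eventually_elim (auto simp: X_def)
    ultimately have "AE w in walks_law. (\<lambda>n. (\<Sum>k<n. X k w - W.expectation (X k)) / real n) \<longlonglongrightarrow> 0"
      by (rule W.bounded_strong_law)
    moreover have "X k = (if T k \<le> K then increment k else (\<lambda>_. 0))" for k
      by (auto simp: X_def)
    then have "X k w - W.expectation (X k) = (if T k \<le> K then increment k w - rwre_mean \<alpha> (T k) else 0)" for k w
      by (simp add: expectation_increment)
    ultimately show ?thesis by simp
  qed
  then have "AE w in walks_law. \<forall>K. (\<lambda>n. (\<Sum>k<n. if T k \<le> K then increment k w - rwre_mean \<alpha> (T k) else 0) / real n) \<longlonglongrightarrow> 0"
    by (simp add: AE_all_countable)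
  moreover have "AE w in walks_law. \<forall>k. \<bar>increment k w\<bar> \<le> real (T k)"
    using AE_increment_bound by (simp add: AE_all_countable)
  ultimately show ?thesis
    using AE_concat_close
    by eventually_elim (unfold v_nu_def, rule strong_law_from_short_blocks[OF abs_rwre_mean_le], blast+)
qed

lemma strong_law: "AE x in rwcre_law \<alpha> \<tau>. (\<lambda>n. real_of_int (x n) / real n) \<longlonglongrightarrow> v_nu \<alpha> A \<nu>"
proof -
  \<comment> \<open>Countable quantifiers exhibit the convergence event as measurable, which is
    needed to move the almost sure statement through \<open>distr\<close>.\<close>
  have lim_iff: "f \<longlonglongrightarrow> c \<longleftrightarrow> (\<forall>m. \<exists>n0. \<forall>n. n0 \<le> n \<longrightarrow> \<bar>f n - c\<bar> < inverse (real (Suc m)))"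
    for f :: "nat \<Rightarrow> real" and c
  proof
    assume "f \<longlonglongrightarrow> c"
    then show "\<forall>m. \<exists>n0. \<forall>n. n0 \<le> n \<longrightarrow> \<bar>f n - c\<bar> < inverse (real (Suc m))"
      by (auto simp: lim_sequentially dist_real_def)
  next
    assume *: "\<forall>m. \<exists>n0. \<forall>n. n0 \<le> n \<longrightarrow> \<bar>f n - c\<bar> < inverse (real (Suc m))"
    show "f \<longlonglongrightarrow> c"
      unfolding lim_sequentially dist_real_def using * reals_Archimedean by (meson less_trans)
  qed
  have "Measurable.pred path_space (\<lambda>x. (\<lambda>n. real_of_int (x n) / real n) \<longlonglongrightarrow> v_nu \<alpha> A \<nu>)"
    unfolding lim_iff by measurable
  then show ?thesis
    unfolding rwcre_law_eq_distr_concat_walks[OF \<tau>]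
    by (subst AE_distr_iff) (auto intro: strong_law_walks simp: pred_def)
qed

text \<open>The measure \<open>\<nu>\<close> charges some \<open>l \<ge> 1\<close>, whose term in
  the series is positive; all other terms are nonnegative.\<close>

lemma sigma_nu_pos:
  assumes "summable (\<lambda>l. pmf \<nu> l * rwre_var \<alpha> l)"
  shows "0 < (\<Sum>l. pmf \<nu> l * rwre_var \<alpha> l)" and "0 < sigma_nu \<alpha> A \<nu>"
    and "(sigma_nu \<alpha> A \<nu>)\<^sup>2 = 1 / A * (\<Sum>l. pmf \<nu> l * rwre_var \<alpha> l)"
proof -
  obtain l where l: "l \<in> set_pmf \<nu>" using set_pmf_not_empty[of \<nu>] by blast
  then have "0 < l" using \<nu>_supp by auto
  then show pos: "0 < (\<Sum>l. pmf \<nu> l * rwre_var \<alpha> l)"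
    using l rwre_var_pos rwre_var_nonneg
    by (intro suminf_pos2[OF assms, of l]) (auto simp: pmf_positive)
  then show "0 < sigma_nu \<alpha> A \<nu>" "(sigma_nu \<alpha> A \<nu>)\<^sup>2 = 1 / A * (\<Sum>l. pmf \<nu> l * rwre_var \<alpha> l)"
    using A by (simp_all add: sigma_nu_def)
qed

lemma central_limit:
  assumes summable: "summable (\<lambda>l. pmf \<nu> l * rwre_var \<alpha> l)"
    and last: "(\<lambda>n. real (n - \<tau> (N n))) \<in> o(\<lambda>n. sqrt (real n))"
    and fast: "(\<lambda>n. enn2real (increment_dist \<tau> \<nu> n)) \<in> o(\<lambda>n. 1 / sqrt (real n))"
  shows "weak_conv_m
    (\<lambda>n. distr (rwcre_law \<alpha> \<tau>) borel
      (\<lambda>x. (real_of_int (x n) - v_nu \<alpha> A \<nu> * real n) / (sigma_nu \<alpha> A \<nu> * sqrt (real n))))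
    std_normal_distribution"
proof -
  let ?v = "v_nu \<alpha> A \<nu>" and ?s = "sigma_nu \<alpha> A \<nu>"
  note s = sigma_nu_pos[OF summable]
  have last': "(\<lambda>n. real (n - \<tau> (N n)) / sqrt (real n)) \<longlonglongrightarrow> 0"
    using smalloD_tendsto[OF last] .
  have fast': "(\<lambda>n. d n * sqrt (real n)) \<longlonglongrightarrow> 0"
    using smalloD_tendsto[OF fast] by (simp add: d_def)
  define F where "F n w = (real_of_int (concat_walks \<tau> w n) - ?v * real n) / (?s * sqrt (real n))" for n w
  define Y where "Y k w = increment k w - rwre_mean \<alpha> (T k)" for k w
  \<comment> \<open>This is the deterministic price for centering at \<open>?v * n\<close> instead
    of at the means of the completed blocks.\<close>
  define c where "c n = (\<Sum>k<N n. rwre_mean \<alpha> (T k)) - ?v * real n" for n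
  have position: "(\<lambda>x. real_of_int (x n)) \<in> borel_measurable path_space" for n :: nat
    by measurable
  have int: "integrable walks_law (increment k)" for k
    using AE_increment_bound[of k] by (intro W.integrable_const_bound[where B="real (T k)"]) auto
  have mean_Y: "W.expectation (Y k) = 0" for k
    unfolding Y_def using int by (simp add: expectation_increment W.prob_space)
  have var_Y: "W.variance (Y k) = rwre_var \<alpha> (T k)" for k
    using variance_increment[of k] by (simp only: mean_Y expectation_increment) (simp add: Y_def)
  have "weak_conv_m (\<lambda>n. distr walks_law borel (F n)) std_normal_distribution"
  proof (rule W.small_summands_central_limit[where Y=Y and N=N and c="\<lambda>k. 2 * real (T k)"
      and s="\<lambda>n. ?s * sqrt (real n)"
      and r="\<lambda>n. (real (n - \<tau> (N n)) / sqrt (real n) + \<bar>c n / sqrt (real n)\<bar>) / ?s"])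
    show "W.indep_vars (\<lambda>_. borel) Y UNIV"
      unfolding Y_def[abs_def]
      by (rule W.indep_vars_compose2[OF indep_increments, where Y="\<lambda>k x. x - rwre_mean \<alpha> (T k)"]) simp
    show "W.expectation (Y k) = 0" for k by (rule mean_Y)
    show "AE w in walks_law. \<bar>Y k w\<bar> \<le> 2 * real (T k)" for k
      using AE_increment_bound[of k]
      by eventually_elim (use abs_rwre_mean_le[of "T k"] in \<open>simp add: Y_def\<close>)
    show "\<forall>\<^sub>F n in sequentially. 0 < ?s * sqrt (real n)"
      using eventually_gt_at_top[of 0] by eventually_elim (use s in simp)
    show "\<forall>\<^sub>F n in sequentially. \<forall>k<N n. 2 * real (T k) \<le> e * (?s * sqrt (real n))" if "0 < e" for e
    proof -
      have "0 < e * ?s / 2" using that s by simp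
      from blocks_small[OF last' this] show ?thesis
        by eventually_elim (auto simp: field_simps)
    qed
    \<comment> \<open>The variance per unit time is the variance per block times the number of
      blocks per unit time; the latter tends to \<open>1 / A\<close>, the factor built into
      \<open>sigma_nu\<close>.\<close>
    have lim: "(\<lambda>n. (\<Sum>k<N n. rwre_var \<alpha> (T k)) / real (N n) * (real (N n) / real n) / ?s\<^sup>2)
       \<longlonglongrightarrow> (\<Sum>l. pmf \<nu> l * rwre_var \<alpha> l) * (1 / A) / ?s\<^sup>2"
      using s A by (intro tendsto_divide[OF tendsto_mult[OF _ N_ratio] tendsto_const]
        variance_average_tendsto[OF rwre_var_nonneg rwre_var_le summable last' fast']) simp_all
    have one: "(\<Sum>l. pmf \<nu> l * rwre_var \<alpha> l) * (1 / A) / ?s\<^sup>2 = 1"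
      using s A by simp
    have "\<forall>\<^sub>F n in sequentially.
        (\<Sum>k<N n. rwre_var \<alpha> (T k)) / real (N n) * (real (N n) / real n) / ?s\<^sup>2
        = (\<Sum>k<N n. W.variance (Y k)) / (?s * sqrt (real n))\<^sup>2"
      using eventually_N_pos by eventually_elim (simp add: var_Y power_mult_distrib)
    with lim[unfolded one] show "(\<lambda>n. (\<Sum>k<N n. W.variance (Y k)) / (?s * sqrt (real n))\<^sup>2) \<longlonglongrightarrow> 1"
      by (rule Lim_transform_eventually)
    show "W.random_variable borel (F n)" for n
    proof -
      have "(\<lambda>w. real_of_int (concat_walks \<tau> w n)) \<in> borel_measurable walks_law"
        by (rule measurable_compose[OF concat_measurable position])
      then show ?thesis unfolding F_def by simp
    qed
    show "\<forall>\<^sub>F n in sequentially. AE w in walks_law. \<bar>F n w - (\<Sum>k<N n. Y k w) / (?s * sqrt (real n))\<bar>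
      \<le> (real (n - \<tau> (N n)) / sqrt (real n) + \<bar>c n / sqrt (real n)\<bar>) / ?s"
    proof (rule always_eventually, rule allI)
      fix n
      show "AE w in walks_law. \<bar>F n w - (\<Sum>k<N n. Y k w) / (?s * sqrt (real n))\<bar>
        \<le> (real (n - \<tau> (N n)) / sqrt (real n) + \<bar>c n / sqrt (real n)\<bar>) / ?s"
        using AE_concat_close
      proof eventually_elim
        case (elim w)
        let ?R = "real_of_int (concat_walks \<tau> w n) - (\<Sum>k<N n. increment k w)"
        have "F n w - (\<Sum>k<N n. Y k w) / (?s * sqrt (real n)) = (?R + c n) / (?s * sqrt (real n))"
          by (simp add: F_def Y_def c_def sum_subtractf flip: diff_divide_distrib)
        also have "\<bar>\<dots>\<bar> = \<bar>?R + c n\<bar> / (?s * sqrt (real n))"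
          using s by (simp add: abs_mult)
        also have "\<dots> \<le> (real (n - \<tau> (N n)) + \<bar>c n\<bar>) / (?s * sqrt (real n))"
          using s elim[rule_format, of n] by (intro divide_right_mono) auto
        also have "\<dots> = (real (n - \<tau> (N n)) / sqrt (real n) + \<bar>c n / sqrt (real n)\<bar>) / ?s"
          by (simp add: add_divide_distrib mult.commute)
        finally show ?case .
      qed
    qed
    have c_lim: "(\<lambda>n. c n / sqrt (real n)) \<longlonglongrightarrow> 0"
      unfolding c_def v_nu_def by (rule centering_negligible[OF abs_rwre_mean_le last' fast'])
    have "(\<lambda>n. (real (n - \<tau> (N n)) / sqrt (real n) + \<bar>c n / sqrt (real n)\<bar>) / ?s) \<longlonglongrightarrow> (0 + \<bar>0\<bar>) / ?s"
      by (intro tendsto_divide tendsto_add tendsto_rabs last' c_lim tendsto_const) (use s in simp)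
    then show "(\<lambda>n. (real (n - \<tau> (N n)) / sqrt (real n) + \<bar>c n / sqrt (real n)\<bar>) / ?s) \<longlonglongrightarrow> 0"
      by simp
  qed
  moreover have "distr (rwcre_law \<alpha> \<tau>) borel
      (\<lambda>x. (real_of_int (x n) - ?v * real n) / (?s * sqrt (real n))) = distr walks_law borel (F n)" for n
  proof -
    have "(\<lambda>x. (real_of_int (x n) - ?v * real n) / (?s * sqrt (real n))) \<in> borel_measurable path_space"
      using position[of n] by simp
    then show ?thesis
      unfolding rwcre_law_eq_distr_concat_walks[OF \<tau>]
      by (subst distr_distr[OF _ concat_measurable]) (auto simp: F_def[abs_def] comp_def)
  qed
  ultimately show ?thesis by simp
qed

end

theorem theorem1:
  fixes \<alpha> :: "real measure" and \<tau> :: "nat \<Rightarrow> nat" and A :: real and \<nu> :: "nat pmf"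
  assumes "real_distribution \<alpha>"
    and "AE p in \<alpha>. 0 < p \<and> p < 1"
    and "mean_log_rho \<alpha> \<le> 0"
    and "cooling_rule \<tau>"
    and "A > 1"
    and "(\<lambda>k. real (\<tau> k)) \<sim>[at_top] (\<lambda>k. A * real k)"
    and "set_pmf \<nu> \<subseteq> {1..}"
    and "(\<lambda>n. increment_dist \<tau> \<nu> n) \<longlonglongrightarrow> 0"
  shows "(AE x in rwcre_law \<alpha> \<tau>. (\<lambda>n. real_of_int (x n) / real n) \<longlonglongrightarrow> v_nu \<alpha> A \<nu>)
    \<and> (summable (\<lambda>l. pmf \<nu> l * rwre_var \<alpha> l)
        \<longrightarrow> (\<lambda>n. real (n - \<tau> (last_resampling \<tau> n))) \<in> o(\<lambda>n. sqrt (real n))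
        \<longrightarrow> (\<lambda>n. enn2real (increment_dist \<tau> \<nu> n)) \<in> o(\<lambda>n. 1 / sqrt (real n))
        \<longrightarrow> weak_conv_m
              (\<lambda>n. distr (rwcre_law \<alpha> \<tau>) borel
                 (\<lambda>x. (real_of_int (x n) - v_nu \<alpha> A \<nu> * real n) / (sigma_nu \<alpha> A \<nu> * sqrt (real n))))
              std_normal_distribution)"
proof -
  interpret rwcre \<alpha> \<tau> A \<nu>
    by (intro rwcre.intro rwre.intro cooling_regime.intro) (fact assms)+
  show ?thesis
    using strong_law central_limit by blast
qed

end
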